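(* Let $N\ge 2$ and $q\ge 2$ be integers, $b=qN$, $\mathcal D=\{0,1,\ldots,N-1\}$ and $\mathcal C=(-\frac N2,\frac N2]\cap\mathbb Z$. Then the spectral pair $(\mu_{b,q\mathcal D},\Lambda(b,\mathcal C))$ has infinitely many primitive complete numbers and infinitely many primitive incomplete numbers.
   Context: For a finite set $B\subset\mathbb R$ and $\rho>1$, $\mu_{\rho,B}$ is the unique Borel probability measure on $\mathbb R$ with $\mu_{\rho,B}(\cdot)=\frac1{\#B}\sum_{a\in B}\mu_{\rho,B}\circ\phi_a^{-1}(\cdot)$, where $\phi_a(x)=\rho^{-1}(x+a)$. Put $q\mathcal D=\{qd:d\in\mathcal D\}$ and $\Lambda(b,\mathcal C)=\{\sum_{k=0}^n b^kc_k: n\ge 0,\ c_k\in\mathcal C\}$. A pair $(\mu,\Lambda)$ of a compactly supported Borel probability measure on $\mathbb R$ and a countable set $\Lambda\subset\mathbb R$ is a spectral pair if $\{e^{-2\pi i\lambda x}:\lambda\in\Lambda\}$ is an orthonormal basis of $L^2(\mu)$. It is known that $(\mu_{b,q\mathcal D},\Lambda(b,\mathcal C))$ is a spectral pair. A real number $t$ is a complete number (of this pair) if $(\mu_{b,q\mathcal D},t\Lambda(b,\mathcal C))$ is also a spectral pair, and an incomplete number otherwise. Let $t$ be a positive integer with $\gcd(t,N)=1$. If $t$ is a complete number, it is called primitive if $\gcd(t,b)=1$. If $t$ is an incomplete number, it is called primitive if every proper (positive) divisor of $t$ is a complete number. *)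

theory Defs
  imports "HOL-Probability.Probability"
begin

section \<open>Self-similar measures with equal weights\<close>

definition ifs_map :: "real \<Rightarrow> real \<Rightarrow> real \<Rightarrow> real" where
  "ifs_map \<rho> a x = (x + a) / \<rho>"

definition is_self_similar_measure :: "real \<Rightarrow> real set \<Rightarrow> real measure \<Rightarrow> bool" where
  "is_self_similar_measure \<rho> B M \<longleftrightarrow>
     prob_space M \<and> sets M = sets borel \<and>
     (\<forall>A\<in>sets borel. measure M A = (1 / real (card B)) * (\<Sum>a\<in>B. measure M (ifs_map \<rho> a -` A)))"

text \<open>Meaningful for \<open>\<rho> > 1\<close> and finite nonempty \<open>B\<close> only, where exactly one such measure exists.\<close>

definition self_similar_measure :: "real \<Rightarrow> real set \<Rightarrow> real measure" where
  "self_similar_measure \<rho> B = (THE M. is_self_similar_measure \<rho> B M)"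


section \<open>Orthonormal bases of complex \<open>L\<^sup>2\<close> spaces\<close>

text \<open>Elements of \<open>L\<^sup>2(M)\<close> are represented by square-integrable functions; no quotient by
  almost-everywhere equality is taken, since the inner product and the norm respect it.\<close>

definition L2_space :: "'a measure \<Rightarrow> ('a \<Rightarrow> complex) set" where
  "L2_space M = {f \<in> borel_measurable M. integrable M (\<lambda>x. (norm (f x))\<^sup>2)}"

definition L2_inner :: "'a measure \<Rightarrow> ('a \<Rightarrow> complex) \<Rightarrow> ('a \<Rightarrow> complex) \<Rightarrow> complex" where
  "L2_inner M f g = (\<integral>x. f x * cnj (g x) \<partial>M)"

definition L2_norm :: "'a measure \<Rightarrow> ('a \<Rightarrow> complex) \<Rightarrow> real" where
  "L2_norm M f = sqrt (\<integral>x. (norm (f x))\<^sup>2 \<partial>M)"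

text \<open>An orthonormal family whose finite linear combinations are dense.\<close>

definition orthonormal_basis_L2 :: "'a measure \<Rightarrow> 'i set \<Rightarrow> ('i \<Rightarrow> 'a \<Rightarrow> complex) \<Rightarrow> bool" where
  "orthonormal_basis_L2 M I e \<longleftrightarrow>
     (\<forall>i\<in>I. e i \<in> L2_space M) \<and>
     (\<forall>i\<in>I. \<forall>j\<in>I. L2_inner M (e i) (e j) = (if i = j then 1 else 0)) \<and>
     (\<forall>f\<in>L2_space M. \<forall>\<epsilon>>0. \<exists>F c. finite F \<and> F \<subseteq> I \<and>
        L2_norm M (\<lambda>x. f x - (\<Sum>i\<in>F. c i * e i x)) < \<epsilon>)"


section \<open>Spectral pairs and complete numbers\<close>

definition compactly_supported :: "real measure \<Rightarrow> bool" where
  "compactly_supported M \<longleftrightarrow> (\<exists>K. compact K \<and> emeasure M (- K) = 0)"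

definition spectral_pair :: "real measure \<Rightarrow> real set \<Rightarrow> bool" where
  "spectral_pair M \<Lambda> \<longleftrightarrow>
     prob_space M \<and> sets M = sets borel \<and> compactly_supported M \<and> countable \<Lambda> \<and>
     orthonormal_basis_L2 M \<Lambda> (\<lambda>l x. exp (- 2 * of_real pi * \<i> * of_real l * of_real x))"

definition digit_expansions :: "real \<Rightarrow> real set \<Rightarrow> real set" where
  "digit_expansions b C = {(\<Sum>k=0..n. b ^ k * c k) | n c. \<forall>k\<le>n. c k \<in> C}"

definition complete_number :: "real measure \<Rightarrow> real set \<Rightarrow> real \<Rightarrow> bool" where
  "complete_number M \<Lambda> t \<longleftrightarrow> spectral_pair M ((\<lambda>l. t * l) ` \<Lambda>)"

definition incomplete_number :: "real measure \<Rightarrow> real set \<Rightarrow> real \<Rightarrow> bool" where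
  "incomplete_number M \<Lambda> t \<longleftrightarrow> \<not> complete_number M \<Lambda> t"

definition primitive_complete_number ::
  "nat \<Rightarrow> nat \<Rightarrow> real measure \<Rightarrow> real set \<Rightarrow> nat \<Rightarrow> bool" where
  "primitive_complete_number N b M \<Lambda> t \<longleftrightarrow>
     t > 0 \<and> gcd t N = 1 \<and> complete_number M \<Lambda> (real t) \<and> gcd t b = 1"

definition primitive_incomplete_number ::
  "nat \<Rightarrow> real measure \<Rightarrow> real set \<Rightarrow> nat \<Rightarrow> bool" where
  "primitive_incomplete_number N M \<Lambda> t \<longleftrightarrow>
     t > 0 \<and> gcd t N = 1 \<and> incomplete_number M \<Lambda> (real t) \<and>
     (\<forall>d. d dvd t \<and> d \<noteq> t \<longrightarrow> complete_number M \<Lambda> (real d))"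

end

theory Submission
  imports Defs "HOL-Number_Theory.Residues"
begin

text \<open>
  The Fourier transform of the measure satisfies \<open>ft \<xi> = mask (\<xi>/b) ft (\<xi>/b)\<close>; it vanishes at
  \<open>b\<^sup>j k\<close> whenever \<open>N\<close> does not divide \<open>k\<close>, and all its zeros are nonzero integers. The first fact
  makes \<open>t\<Lambda>\<close> orthonormal whenever \<open>gcd t N = 1\<close>. Let \<open>T\<close> be the closure of the set of numbers
  \<open>b\<^bsup>-n\<^esup> l\<close> with \<open>l\<close> an \<open>n\<close>-digit element of \<open>\<Lambda>\<close>. If \<open>tT\<close> contains no nonzero integer, then \<open>ft\<close>
  is bounded away from zero near \<open>tT\<close>, and Strichartz' domination argument shows that
  \<open>t\<Lambda>\<close> is complete. Conversely a nonzero integer \<open>x\<close> with \<open>x (b\<^sup>m - 1) = t s\<close>, where \<open>s > 0\<close> has \<open>m\<close> digits,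
  gives an exponential of frequency \<open>-x\<close> orthogonal to all of \<open>t\<Lambda>\<close>.

  The integers in \<open>tT\<close> are, modulo \<open>t\<close>, stable under multiplication by \<open>b\<close>. For \<open>t = N b\<^sup>n - 1\<close> they are therefore
  stable under multiplication by \<open>q\<close>, which forces them to vanish; this gives the primitive
  complete numbers. Every repunit \<open>1 + b + \<dots> + b\<^bsup>m-1\<^esup>\<close> with \<open>m \<ge> b - 1\<close> is incomplete, and for suitable \<open>m\<close> it has
  no small divisors except \<open>1\<close>; its least incomplete divisor is then a large primitive incomplete number.
\<close>

section \<open>Self-similar measures\<close>

text \<open>\<open>M\<close> is the image of (uniform measure on \<open>B\<close>) times
  \<open>M\<close> under \<open>(a, x) \<mapsto> ifs_map \<rho> a x\<close>, so the identity is
  Fubini. The bound \<open>K\<close> provides integrability on the product.\<close>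

lemma self_similar_integral:
  fixes f :: "real \<Rightarrow> complex"
  assumes M: "is_self_similar_measure \<rho> B M" and B: "finite B" "B \<noteq> {}"
    and f[measurable]: "f \<in> borel_measurable borel" and K: "\<And>x. norm (f x) \<le> K"
  shows "(\<integral>x. f x \<partial>M) = (\<Sum>a\<in>B. \<integral>x. f (ifs_map \<rho> a x) \<partial>M) / of_nat (card B)"
proof -
  interpret prob_space M using M by (simp add: is_self_similar_measure_def)
  have sM[measurable_cong]: "sets M = sets borel" using M by (simp add: is_self_similar_measure_def)
  have spM: "space M = UNIV" using sets_eq_imp_space_eq[OF sM] by simp
  define P where "P = measure_pmf (pmf_of_set B)"
  interpret P: prob_space P unfolding P_def by (rule measure_pmf.prob_space_axioms)
  interpret PM: pair_prob_space P M ..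
  have [measurable]: "(\<lambda>z. fst z :: real) \<in> borel_measurable (P \<Otimes>\<^sub>M M)"
    by (rule measurable_compose[OF measurable_fst]) (simp add: P_def)
  have [measurable]: "(\<lambda>(a, x). ifs_map \<rho> a x) \<in> borel_measurable (P \<Otimes>\<^sub>M M)"
    unfolding ifs_map_def case_prod_beta by measurable
  have [measurable]: "ifs_map \<rho> a \<in> borel_measurable borel" for a
    unfolding ifs_map_def by measurable
  have eq: "M = distr (P \<Otimes>\<^sub>M M) borel (\<lambda>(a, x). ifs_map \<rho> a x)"
  proof (rule measure_eqI)
    fix A assume "A \<in> sets M"
    then have A[measurable]: "A \<in> sets borel" by (simp add: sM)
    have "emeasure (distr (P \<Otimes>\<^sub>M M) borel (\<lambda>(a, x). ifs_map \<rho> a x)) A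
        = emeasure (P \<Otimes>\<^sub>M M) ((\<lambda>(a, x). ifs_map \<rho> a x) -` A \<inter> space (P \<Otimes>\<^sub>M M))"
      by (rule emeasure_distr) auto
    also have "\<dots> = (\<integral>\<^sup>+a. emeasure M (ifs_map \<rho> a -` A) \<partial>P)"
      by (subst emeasure_pair_measure_alt, measurable)
        (auto intro!: nn_integral_cong arg_cong[where f="emeasure M"] simp: space_pair_measure P_def spM)
    also have "\<dots> = (\<Sum>a\<in>B. emeasure M (ifs_map \<rho> a -` A)) / card B"
      unfolding P_def using B by (simp add: nn_integral_pmf_of_set)
    also have "\<dots> = ennreal (\<Sum>a\<in>B. measure M (ifs_map \<rho> a -` A)) / ennreal (card B)"
      by (simp add: emeasure_eq_measure ennreal_of_nat_eq_real_of_nat)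
    also have "\<dots> = ennreal ((\<Sum>a\<in>B. measure M (ifs_map \<rho> a -` A)) / card B)"
      using B by (intro divide_ennreal) (auto simp: sum_nonneg card_gt_0_iff)
    also have "\<dots> = emeasure M A"
      using M A by (simp add: is_self_similar_measure_def emeasure_eq_measure)
    finally show "emeasure M A = emeasure (distr (P \<Otimes>\<^sub>M M) borel (\<lambda>(a, x). ifs_map \<rho> a x)) A" ..
  qed (simp add: sM)
  have "(\<integral>x. f x \<partial>M) = (\<integral>z. f (case z of (a, x) \<Rightarrow> ifs_map \<rho> a x) \<partial>(P \<Otimes>\<^sub>M M))"
    by (subst eq, rule integral_distr) auto
  also have "\<dots> = (\<integral>a. \<integral>x. f (ifs_map \<rho> a x) \<partial>M \<partial>P)"
    by (subst PM.integral_fst'[symmetric])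
      (auto intro!: PM.integrable_const_bound[where B=K] K simp: case_prod_beta)
  also have "\<dots> = (\<Sum>a\<in>B. \<integral>x. f (ifs_map \<rho> a x) \<partial>M) / of_nat (card B)"
    unfolding P_def using B
    by (subst integral_measure_pmf[of B])
      (auto simp: pmf_of_set scaleR_conv_of_real sum_divide_distrib)
  finally show ?thesis .
qed

lemma self_similar_char:
  assumes M: "is_self_similar_measure \<rho> B M" and B: "finite B" "B \<noteq> {}"
  shows "char M t = (\<Sum>a\<in>B. iexp (t * a / \<rho>)) / of_nat (card B) * char M (t / \<rho>)"
proof -
  have "char M t = (\<Sum>a\<in>B. \<integral>x. iexp (t * ifs_map \<rho> a x) \<partial>M) / of_nat (card B)"
    unfolding char_def by (rule self_similar_integral[OF M B, where K=1]) auto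
  moreover have "(\<integral>x. iexp (t * ifs_map \<rho> a x) \<partial>M) = iexp (t * a / \<rho>) * char M (t / \<rho>)" for a
  proof -
    have "iexp (t * ifs_map \<rho> a x) = iexp (t * a / \<rho>) * iexp (t / \<rho> * x)" for x
      unfolding exp_add[symmetric] ifs_map_def
      by (rule arg_cong[where f=exp]) (simp add: add_divide_distrib algebra_simps)
    then show ?thesis by (simp add: char_def)
  qed
  ultimately show ?thesis by (simp add: sum_distrib_right)
qed

lemma real_distribution_self_similar:
  "is_self_similar_measure \<rho> B M \<Longrightarrow> real_distribution M"
  unfolding is_self_similar_measure_def real_distribution_def real_distribution_axioms_def
  using sets_eq_imp_space_eq[of M borel] by auto

text \<open>Both characteristic functions satisfy the same refinement equation with a factor of
  modulus at most 1. Their distance at \<open>t\<close> is thus bounded by that at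
  \<open>t / \<rho> ^ n\<close>, which tends to 0 by continuity at 0.\<close>

lemma self_similar_unique:
  assumes "\<rho> > 1" and B: "finite B" "B \<noteq> {}"
    and M1: "is_self_similar_measure \<rho> B M1" and M2: "is_self_similar_measure \<rho> B M2"
  shows "M1 = M2"
proof (rule Levy_uniqueness)
  show r1: "real_distribution M1" and r2: "real_distribution M2"
    using M1 M2 by (simp_all add: real_distribution_self_similar)
  interpret M1: real_distribution M1 by (rule r1)
  interpret M2: real_distribution M2 by (rule r2)
  let ?D = "\<lambda>t. norm (char M1 t - char M2 t)"
  have step: "?D t \<le> ?D (t / \<rho>)" for t
  proof -
    let ?m = "(\<Sum>a\<in>B. iexp (t * a / \<rho>)) / of_nat (card B)"
    have "norm (\<Sum>a\<in>B. iexp (t * a / \<rho>)) \<le> (\<Sum>a\<in>B. 1)"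
      by (rule sum_norm_le) (metis norm_exp_i_times order_refl)
    then have "norm ?m \<le> 1" using B by (simp add: norm_divide divide_le_eq card_gt_0_iff)
    moreover have "char M1 t - char M2 t = ?m * (char M1 (t / \<rho>) - char M2 (t / \<rho>))"
      by (simp only: self_similar_char[OF M1 B, of t] self_similar_char[OF M2 B, of t] right_diff_distrib)
    ultimately show ?thesis
      by (simp only: norm_mult) (rule mult_left_le_one_le, auto)
  qed
  have iter: "?D t \<le> ?D (t / \<rho> ^ n)" for t n
  proof (induction n)
    case (Suc n)
    then show ?case using step[of "t / \<rho> ^ n"] by (simp add: mult.commute)
  qed simp
  have "char M1 t = char M2 t" for t
  proof -
    have "(\<lambda>n. t / \<rho> ^ n) \<longlonglongrightarrow> 0"
      using \<open>\<rho> > 1\<close> by (rule LIMSEQ_divide_realpow_zero)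
    then have "(\<lambda>n. ?D (t / \<rho> ^ n)) \<longlonglongrightarrow> ?D 0"
      by (intro tendsto_norm tendsto_diff isCont_tendsto_compose[OF M1.isCont_char]
          isCont_tendsto_compose[OF M2.isCont_char])
    then have "?D t \<le> ?D 0"
      by (rule LIMSEQ_le_const) (use iter in auto)
    then show ?thesis by (simp add: M1.char_zero M2.char_zero)
  qed
  then show "char M1 = char M2" by (rule ext)
qed

text \<open>The law of \<open>\<Sum>n. a\<^sub>n / \<rho>\<^bsup>n+1\<^esup>\<close> for independent uniform digits \<open>a\<^sub>n\<close>.\<close>

lemma self_similar_exists:
  assumes "\<rho> > 1" and B: "finite B" "B \<noteq> {}" "B \<subseteq> {0..\<rho> - 1}"
  obtains M where "is_self_similar_measure \<rho> B M" "AE x in M. x \<in> {0..1}"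
proof -
  define P where "P = measure_pmf (pmf_of_set B)"
  interpret P: prob_space P unfolding P_def by (rule measure_pmf.prob_space_axioms)
  define S where "S = stream_space P"
  interpret S: prob_space S unfolding S_def by (rule P.prob_space_stream_space)
  \<comment> \<open>The streams range over all reals. Sending digits outside \<open>B\<close> to 0
    makes the bounds below hold for every stream, not just almost every one.\<close>
  define g where "g = (\<lambda>d. if d \<in> B then d else 0)"
  have g: "0 \<le> g d" "g d \<le> \<rho> - 1" for d using B(3) \<open>\<rho> > 1\<close> by (auto simp: g_def)
  define T where "T = (\<lambda>\<omega> n. g (\<omega> !! n) / \<rho> ^ Suc n)"
  define X where "X = (\<lambda>\<omega>. \<Sum>n. T \<omega> n)"
  have geo: "(\<lambda>n. (\<rho> - 1) / \<rho> ^ Suc n) sums 1"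
  proof -
    have "(\<lambda>n. (\<rho> - 1) / \<rho> * (1 / \<rho>) ^ n) sums ((\<rho> - 1) / \<rho> * (1 / (1 - 1 / \<rho>)))"
      using \<open>\<rho> > 1\<close> by (intro sums_mult geometric_sums) auto
    moreover have "(\<rho> - 1) / \<rho> * (1 / (1 - 1 / \<rho>)) = 1" using \<open>\<rho> > 1\<close> by (simp add: field_simps)
    ultimately have "(\<lambda>n. (\<rho> - 1) / \<rho> * (1 / \<rho>) ^ n) sums 1" by metis
    then show ?thesis by (simp add: power_divide)
  qed
  have T: "0 \<le> T \<omega> n" "T \<omega> n \<le> (\<rho> - 1) / \<rho> ^ Suc n" for \<omega> n
    using g[of "\<omega> !! n"] \<open>\<rho> > 1\<close> by (auto simp: T_def intro!: divide_right_mono)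
  have sT: "summable (T \<omega>)" for \<omega>
    by (rule summable_comparison_test'[OF sums_summable[OF geo], of 0]) (use T in auto)
  have X01: "X \<omega> \<in> {0..1}" for \<omega>
    using suminf_le[OF T(2) sT sums_summable[OF geo]] suminf_nonneg[OF sT T(1)] sums_unique[OF geo]
    by (simp add: X_def)
  \<comment> \<open>Prepending a digit acts as one map of the iterated function system;
    self-similarity follows by conditioning on the first digit.\<close>
  have Xs: "X (a ## \<omega>) = ifs_map \<rho> (g a) (X \<omega>)" for a \<omega>
  proof -
    have "X (a ## \<omega>) = T (a ## \<omega>) 0 + (\<Sum>n. T (a ## \<omega>) (Suc n))"
      unfolding X_def by (subst suminf_split_head[OF sT]) simp
    also have "(\<lambda>n. T (a ## \<omega>) (Suc n)) = (\<lambda>n. T \<omega> n / \<rho>)" by (auto simp: T_def)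
    finally show ?thesis using suminf_divide[OF sT, of \<omega> \<rho>]
      by (simp add: T_def X_def ifs_map_def add_divide_distrib)
  qed
  have [measurable]: "(\<lambda>\<omega>. g (\<omega> !! n)) \<in> borel_measurable S" for n
    unfolding S_def by (rule measurable_compose[OF measurable_snth]) (simp add: P_def)
  have X[measurable]: "X \<in> borel_measurable S" unfolding X_def T_def by measurable
  define M where "M = distr S borel X"
  have "is_self_similar_measure \<rho> B M"
    unfolding is_self_similar_measure_def
  proof (intro conjI ballI)
    show "prob_space M" unfolding M_def by (rule S.prob_space_distr) simp
    interpret M: prob_space M by fact
    fix A :: "real set" assume [measurable]: "A \<in> sets borel"
    have [measurable]: "ifs_map \<rho> a \<in> borel_measurable borel" for a
      unfolding ifs_map_def by measurable
    have spS: "space S = UNIV" by (simp add: S_def P_def space_stream_space)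
    have eA: "emeasure M C = emeasure S (X -` C)" if "C \<in> sets borel" for C
      unfolding M_def using that by (subst emeasure_distr) (auto simp: spS)
    have vm: "ifs_map \<rho> a -` A \<in> sets borel" for a
      using measurable_sets[of "ifs_map \<rho> a" borel borel A] by simp
    have "emeasure M A = (\<integral>\<^sup>+a. emeasure S {\<omega>\<in>space S. a ## \<omega> \<in> X -` A} \<partial>P)"
      unfolding S_def eA[OF \<open>A \<in> sets borel\<close>, unfolded S_def]
      by (rule P.emeasure_stream_space) (use measurable_sets[OF X, of A] spS S_def in auto)
    also have "\<dots> = (\<integral>\<^sup>+a. emeasure M (ifs_map \<rho> (g a) -` A) \<partial>P)"
      by (intro nn_integral_cong) (auto simp: eA[OF vm] Xs spS intro!: arg_cong[where f="emeasure S"])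
    also have "\<dots> = (\<Sum>a\<in>B. emeasure M (ifs_map \<rho> (g a) -` A)) / card B"
      unfolding P_def using B by (simp add: nn_integral_pmf_of_set)
    also have "\<dots> = ennreal (\<Sum>a\<in>B. measure M (ifs_map \<rho> a -` A)) / ennreal (card B)"
      by (simp add: M.emeasure_eq_measure ennreal_of_nat_eq_real_of_nat g_def)
    also have "\<dots> = ennreal ((\<Sum>a\<in>B. measure M (ifs_map \<rho> a -` A)) / card B)"
      using B by (intro divide_ennreal) (auto simp: sum_nonneg card_gt_0_iff)
    finally show "measure M A = 1 / real (card B) * (\<Sum>a\<in>B. measure M (ifs_map \<rho> a -` A))"
      by (simp add: M.emeasure_eq_measure sum_nonneg)
  qed (simp add: M_def)
  moreover have "AE x in M. x \<in> {0..1}"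
    unfolding M_def by (subst AE_distr_iff) (use X01 in auto)
  ultimately show thesis by (rule that)
qed

lemma self_similar_measure_eq:
  assumes "\<rho> > 1" "finite B" "B \<noteq> {}" "is_self_similar_measure \<rho> B M"
  shows "self_similar_measure \<rho> B = M"
  unfolding self_similar_measure_def
  by (rule the_equality) (use assms self_similar_unique in blast)+

section \<open>Closed subspaces of \<open>L\<^sup>2\<close> containing all exponentials\<close>

lemma L2_space_AE_bounded:
  assumes "finite_measure M" "f \<in> borel_measurable M" "AE x in M. norm (f x) \<le> K"
  shows "f \<in> L2_space M"
proof -
  interpret finite_measure M by fact
  have "AE x in M. norm ((norm (f x))\<^sup>2) \<le> K\<^sup>2"
    using assms(3) by eventually_elim (simp add: power_mono)
  then show ?thesis
    using assms(2) unfolding L2_space_def by (auto intro!: integrable_const_bound[where B="K\<^sup>2"])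
qed

lemma norm_add_square_le:
  fixes a b :: complex
  shows "(norm (a + b))\<^sup>2 \<le> 2 * (norm a)\<^sup>2 + 2 * (norm b)\<^sup>2"
proof -
  have "(norm (a + b))\<^sup>2 \<le> (norm a + norm b)\<^sup>2" by (intro power_mono norm_triangle_ineq) auto
  also have "\<dots> \<le> 2 * (norm a)\<^sup>2 + 2 * (norm b)\<^sup>2"
    using zero_le_power2[of "norm a - norm b"] by (simp add: power2_eq_square algebra_simps)
  finally show ?thesis .
qed

lemma L2_space_add:
  assumes "f \<in> L2_space M" "g \<in> L2_space M"
  shows "(\<lambda>x. f x + g x) \<in> L2_space M"
proof -
  have [measurable]: "f \<in> borel_measurable M" "g \<in> borel_measurable M"
    and i: "integrable M (\<lambda>x. (norm (f x))\<^sup>2)" "integrable M (\<lambda>x. (norm (g x))\<^sup>2)"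
    using assms by (auto simp: L2_space_def)
  have "integrable M (\<lambda>x. (norm (f x + g x))\<^sup>2)"
    by (rule Bochner_Integration.integrable_bound[where f="\<lambda>x. 2 * (norm (f x))\<^sup>2 + 2 * (norm (g x))\<^sup>2"])
      (use i norm_add_square_le in auto)
  then show ?thesis by (simp add: L2_space_def)
qed

lemma L2_space_scale: "f \<in> L2_space M \<Longrightarrow> (\<lambda>x. c * f x) \<in> L2_space M"
  by (auto simp: L2_space_def norm_mult power_mult_distrib)

lemma L2_space_diff:
  assumes "f \<in> L2_space M" "g \<in> L2_space M"
  shows "(\<lambda>x. f x - g x) \<in> L2_space M"
  using L2_space_add[OF assms(1) L2_space_scale[OF assms(2), of "-1"]] by simp

lemma L2_integral_add_le:
  assumes "f \<in> L2_space M" "g \<in> L2_space M"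
  shows "(\<integral>x. (norm (f x + g x))\<^sup>2 \<partial>M) \<le> 2 * (\<integral>x. (norm (f x))\<^sup>2 \<partial>M) + 2 * (\<integral>x. (norm (g x))\<^sup>2 \<partial>M)"
proof -
  have "(\<integral>x. (norm (f x + g x))\<^sup>2 \<partial>M) \<le> (\<integral>x. 2 * (norm (f x))\<^sup>2 + 2 * (norm (g x))\<^sup>2 \<partial>M)"
    using assms L2_space_add[OF assms] norm_add_square_le
    by (intro integral_mono) (auto simp: L2_space_def)
  then show ?thesis using assms by (simp add: L2_space_def)
qed

lemma L2_norm_less_iff: "\<epsilon> > 0 \<Longrightarrow> L2_norm M f < \<epsilon> \<longleftrightarrow> (\<integral>x. (norm (f x))\<^sup>2 \<partial>M) < \<epsilon>\<^sup>2"
  unfolding L2_norm_def by (metis real_sqrt_abs real_sqrt_less_iff abs_of_pos)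

text \<open>Elements are functions, not classes. Since closedness is stated through the squared
  distance, such a \<open>V\<close> is automatically invariant under almost-everywhere modification
  within \<open>L2_space M\<close>.\<close>

definition L2_closed_subspace :: "'a measure \<Rightarrow> ('a \<Rightarrow> complex) set \<Rightarrow> bool" where
  "L2_closed_subspace M V \<longleftrightarrow> V \<subseteq> L2_space M \<and> (\<lambda>x. 0) \<in> V \<and>
     (\<forall>f\<in>V. \<forall>g\<in>V. (\<lambda>x. f x + g x) \<in> V) \<and> (\<forall>c. \<forall>f\<in>V. (\<lambda>x. c * f x) \<in> V) \<and>
     (\<forall>f\<in>L2_space M. (\<forall>\<epsilon>>0. \<exists>g\<in>V. (\<integral>x. (norm (f x - g x))\<^sup>2 \<partial>M) < \<epsilon>) \<longrightarrow> f \<in> V)"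

lemma L2_closed_subspace_add:
  "L2_closed_subspace M V \<Longrightarrow> f \<in> V \<Longrightarrow> g \<in> V \<Longrightarrow> (\<lambda>x. f x + g x) \<in> V"
  by (simp add: L2_closed_subspace_def)

lemma L2_closed_subspace_scale:
  "L2_closed_subspace M V \<Longrightarrow> f \<in> V \<Longrightarrow> (\<lambda>x. c * f x) \<in> V"
  by (simp add: L2_closed_subspace_def)

lemma L2_closed_subspace_limit:
  assumes "L2_closed_subspace M V" "f \<in> L2_space M"
    and "\<And>\<epsilon>. \<epsilon> > 0 \<Longrightarrow> \<exists>g\<in>V. (\<integral>x. (norm (f x - g x))\<^sup>2 \<partial>M) < \<epsilon>"
  shows "f \<in> V"
  using assms by (simp add: L2_closed_subspace_def)

lemma L2_closed_subspace_sum: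
  assumes "L2_closed_subspace M V" "finite F" "\<And>i. i \<in> F \<Longrightarrow> f i \<in> V"
  shows "(\<lambda>x. \<Sum>i\<in>F. f i x) \<in> V"
  using assms(2,3) by induction (use assms(1) in \<open>auto simp: L2_closed_subspace_def\<close>)

lemma L2_closed_subspace_dominated:
  assumes V: "L2_closed_subspace M V" and s: "\<And>n. s n \<in> V" and f: "f \<in> L2_space M"
    and w: "integrable M w" "\<And>n. AE x in M. (norm (f x - s n x))\<^sup>2 \<le> w x"
    and lim: "AE x in M. (\<lambda>n. s n x) \<longlonglongrightarrow> f x"
  shows "f \<in> V"
proof -
  have [measurable]: "f \<in> borel_measurable M" "s n \<in> borel_measurable M" for n
    using f s V by (auto simp: L2_space_def L2_closed_subspace_def)
  have "(\<lambda>n. \<integral>x. (norm (f x - s n x))\<^sup>2 \<partial>M) \<longlonglongrightarrow> (\<integral>x. 0 \<partial>M)"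
  proof (rule integral_dominated_convergence[where w=w])
    show "AE x in M. (\<lambda>n. (norm (f x - s n x))\<^sup>2) \<longlonglongrightarrow> 0"
      using lim
    proof eventually_elim
      case (elim x)
      then have "(\<lambda>n. (norm (f x - s n x))\<^sup>2) \<longlonglongrightarrow> (norm (f x - f x))\<^sup>2" by (intro tendsto_intros)
      then show ?case by simp
    qed
  qed (use w in auto)
  then have lim0: "(\<lambda>n. \<integral>x. (norm (f x - s n x))\<^sup>2 \<partial>M) \<longlonglongrightarrow> 0" by simp
  have "\<exists>g\<in>V. (\<integral>x. (norm (f x - g x))\<^sup>2 \<partial>M) < \<epsilon>" if "\<epsilon> > 0" for \<epsilon>
  proof -
    have "\<exists>n. (\<integral>x. (norm (f x - s n x))\<^sup>2 \<partial>M) < \<epsilon>"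
      by (rule eventually_happens'[OF sequentially_bot order_tendstoD(2)[OF lim0 that]])
    then obtain n where "(\<integral>x. (norm (f x - s n x))\<^sup>2 \<partial>M) < \<epsilon>" ..
    then show ?thesis by (rule bexI[OF _ s])
  qed
  then show ?thesis by (rule L2_closed_subspace_limit[OF V f])
qed

lemma L2_closed_subspace_bounded_limit:
  assumes M: "finite_measure M" and V: "L2_closed_subspace M V" and s: "\<And>n. s n \<in> V"
    and f: "f \<in> borel_measurable M"
    and K: "\<And>n. AE x in M. norm (s n x) \<le> K"
    and lim: "AE x in M. (\<lambda>n. s n x) \<longlonglongrightarrow> f x"
  shows "f \<in> V"
proof -
  interpret finite_measure M by fact
  have fK: "AE x in M. norm (f x) \<le> K"
  proof -
    have "AE x in M. \<forall>n. norm (s n x) \<le> K" using K by (simp add: AE_all_countable)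
    with lim show ?thesis
    proof eventually_elim
      case (elim x)
      then have "(\<lambda>n. norm (s n x)) \<longlonglongrightarrow> norm (f x)" by (intro tendsto_norm)
      then show ?case by (rule LIMSEQ_le_const2) (use elim in auto)
    qed
  qed
  show ?thesis
  proof (rule L2_closed_subspace_dominated[OF V s L2_space_AE_bounded[OF M f fK]])
    show "integrable M (\<lambda>x. (2 * K)\<^sup>2)" by simp
    show "AE x in M. (norm (f x - s n x))\<^sup>2 \<le> (2 * K)\<^sup>2" for n
      using fK K[of n]
    proof eventually_elim
      case (elim x)
      then have "norm (f x - s n x) \<le> 2 * K" using norm_triangle_ineq4[of "f x" "s n x"] by linarith
      then show ?case by (intro power_mono) auto
    qed
  qed (rule lim)
qed

section \<open>Density of the exponentials for measures on the unit interval\<close>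

definition expo :: "real \<Rightarrow> real \<Rightarrow> complex" where
  "expo l x = exp (- 2 * of_real pi * \<i> * of_real l * of_real x)"

lemma expo_eq_iexp: "expo l x = iexp (- 2 * pi * l * x)"
  unfolding expo_def by (rule arg_cong[where f=exp]) (simp add: algebra_simps)

lemma norm_expo [simp]: "norm (expo l x) = 1"
  unfolding expo_eq_iexp by (rule norm_exp_i_times)

lemma expo_0 [simp]: "expo 0 x = 1" by (simp add: expo_def)

lemma expo_add: "expo (l + l') x = expo l x * expo l' x"
  by (simp add: expo_def exp_add[symmetric] algebra_simps)

lemma cnj_expo: "cnj (expo l x) = expo (- l) x"
  by (simp add: expo_def exp_cnj)

lemma expo_measurable [measurable]: "expo l \<in> borel_measurable borel"
  unfolding expo_def by measurable

text \<open>Differentiation in the frequency: difference quotients of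
  \<open>\<xi> \<mapsto> x^n expo \<xi> x\<close> lie in \<open>V\<close>, are bounded on the unit
  interval, and converge to a constant multiple of \<open>x^(n+1) expo \<xi> x\<close>. The factor
  \<open>expo \<xi>\<close> is what makes the induction run.\<close>

lemma monomial_expo_in_closed_subspace:
  assumes M: "finite_measure M" "sets M = sets borel" "AE x in M. x \<in> {0..1}"
    and V: "L2_closed_subspace M V" "\<And>\<xi>. expo \<xi> \<in> V"
  shows "(\<lambda>x. of_real x ^ n * expo \<xi> x) \<in> V"
proof (induction n arbitrary: \<xi>)
  case 0
  then show ?case using V(2) by simp
next
  case (Suc n)
  have [measurable_cong]: "sets M = sets borel" by (rule M)
  define s where "s k x = of_nat (Suc k) * (of_real x ^ n * expo (\<xi> + 1 / Suc k) x + - 1 * (of_real x ^ n * expo \<xi> x))"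
    for k x
  let ?f = "\<lambda>x. of_real x ^ n * expo \<xi> x * (- 2 * pi * \<i> * of_real x)"
  have s_eq: "s k x = of_real x ^ n * expo \<xi> x * ((expo (1 / Suc k) x - 1) / of_real (1 / Suc k))" for k x
    by (simp add: s_def expo_add algebra_simps)
  have "?f \<in> V"
  proof (rule L2_closed_subspace_bounded_limit[OF M(1) V(1), where s=s and K="2 * pi"])
    have "(\<lambda>x. of_real x ^ n * expo (\<xi> + 1 / Suc k) x + - 1 * (of_real x ^ n * expo \<xi> x)) \<in> V" for k
      by (intro L2_closed_subspace_add[OF V(1)] L2_closed_subspace_scale[OF V(1)] Suc)
    then show "s k \<in> V" for k
      unfolding s_def by (intro L2_closed_subspace_scale[OF V(1)])
    show "AE x in M. norm (s k x) \<le> 2 * pi" for k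
      using M(3)
    proof eventually_elim
      case (elim x)
      \<comment> \<open>This is \<open>|e^(iy) - 1| \<le> |y|\<close>.\<close>
      have "norm (expo (1 / Suc k) x - 1) \<le> \<bar>- 2 * pi * (1 / Suc k) * x\<bar>"
        using iexp_approx1[of "- 2 * pi * (1 / Suc k) * x" 0] by (simp add: expo_eq_iexp)
      moreover have "norm ((expo (1 / Suc k) x - 1) / of_real (1 / Suc k)) = norm (expo (1 / Suc k) x - 1) / (1 / Suc k)"
        by (simp only: norm_divide norm_of_real) simp
      ultimately have "norm ((expo (1 / Suc k) x - 1) / of_real (1 / Suc k)) \<le> 2 * pi * x"
        using elim by (simp add: abs_mult field_simps del: of_nat_Suc)
      also have "\<dots> \<le> 2 * pi * 1" using elim by (intro mult_left_mono) auto
      finally have *: "norm ((expo (1 / Suc k) x - 1) / of_real (1 / Suc k)) \<le> 2 * pi" by simp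
      have "norm (of_real x ^ n * expo \<xi> x) \<le> 1"
        using elim by (simp add: norm_mult norm_power power_le_one)
      then show ?case
        using mult_mono[OF _ *, of "norm (of_real x ^ n * expo \<xi> x)" 1] unfolding s_eq norm_mult by simp
    qed
    have "(\<lambda>k. s k x) \<longlonglongrightarrow> ?f x" for x
      unfolding s_eq
    proof (rule tendsto_mult_left)
      have "((\<lambda>h::complex. exp (- 2 * of_real pi * \<i> * h * of_real x)) has_field_derivative - 2 * pi * \<i> * of_real x) (at 0)"
        by (auto intro!: derivative_eq_intros)
      then have "(\<lambda>h::complex. (exp (- 2 * of_real pi * \<i> * h * of_real x) - 1) / h) \<midarrow>0\<rightarrow> - 2 * pi * \<i> * of_real x"
        by (simp add: DERIV_def)
      moreover have "filterlim (\<lambda>k. complex_of_real (1 / Suc k)) (at 0) sequentially"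
        unfolding filterlim_at
      proof
        have "(\<lambda>k. 1 / real (Suc k)) \<longlonglongrightarrow> 0" using LIMSEQ_inverse_real_of_nat by (simp add: inverse_eq_divide)
        from tendsto_of_real[OF this, where 'a=complex] show "(\<lambda>k. complex_of_real (1 / Suc k)) \<longlonglongrightarrow> 0"
          by (simp only: of_real_0)
      qed (simp del: of_nat_Suc)
      ultimately have "(\<lambda>k. (exp (- 2 * of_real pi * \<i> * complex_of_real (1 / Suc k) * of_real x) - 1) / complex_of_real (1 / Suc k))
          \<longlonglongrightarrow> - 2 * pi * \<i> * of_real x"
        by (rule filterlim_compose)
      then show "(\<lambda>k. (expo (1 / Suc k) x - 1) / of_real (1 / Suc k)) \<longlonglongrightarrow> - 2 * pi * \<i> * of_real x"
        by (simp only: expo_def)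
    qed
    then show "AE x in M. (\<lambda>k. s k x) \<longlonglongrightarrow> ?f x" by simp
  qed measurable
  then have "(\<lambda>x. (1 / (- 2 * pi * \<i>)) * ?f x) \<in> V"
    by (rule L2_closed_subspace_scale[OF V(1)])
  then show ?case by (simp add: field_simps)
qed

text \<open>Weierstrass approximation on \<open>{0..1}\<close>; the values of \<open>g\<close>
  elsewhere do not affect the integral.\<close>

lemma continuous_in_closed_subspace:
  fixes g :: "real \<Rightarrow> real"
  assumes M: "prob_space M" "sets M = sets borel" "AE x in M. x \<in> {0..1}"
    and V: "L2_closed_subspace M V" "\<And>\<xi>. expo \<xi> \<in> V"
    and g: "continuous_on UNIV g"
  shows "(\<lambda>x. of_real (g x)) \<in> V"
proof -
  interpret prob_space M by (rule M)
  have [measurable_cong]: "sets M = sets borel" by (rule M)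
  have [measurable]: "g \<in> borel_measurable borel" using g by (rule borel_measurable_continuous_onI)
  have g01: "continuous_on {0..1} g" using g continuous_on_subset by blast
  have "bounded (g ` {0..1})" using compact_continuous_image[OF g01] compact_imp_bounded by auto
  then obtain K where "\<forall>y\<in>g ` {0..1}. norm y \<le> K"
    unfolding bounded_iff by blast
  then have L2: "(\<lambda>x. of_real (g x)) \<in> L2_space M"
    using M(3) by (intro L2_space_AE_bounded[where K=K]) (auto intro: finite_measure_axioms)
  have "\<exists>h\<in>V. (\<integral>x. (norm (of_real (g x) - h x))\<^sup>2 \<partial>M) < \<epsilon>" if "\<epsilon> > 0" for \<epsilon>
  proof -
    define \<delta> where "\<delta> = sqrt (\<epsilon> / 2)"
    have \<delta>: "\<delta> > 0" "\<delta>\<^sup>2 = \<epsilon> / 2" using that by (auto simp: \<delta>_def)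
    obtain p where p: "real_polynomial_function p" "\<And>x. x \<in> {0..1} \<Longrightarrow> \<bar>g x - p x\<bar> < \<delta>"
      using Stone_Weierstrass_real_polynomial_function[OF _ g01 \<delta>(1)] by auto
    obtain a n where p_eq: "p = (\<lambda>x. \<Sum>i\<le>n. a i * x ^ i)"
      using p(1) by (auto simp: real_polynomial_function_iff_sum)
    have "(\<lambda>x. of_real x ^ i) \<in> V" for i
      using monomial_expo_in_closed_subspace[OF _ M(2,3) V, of i 0] finite_measure_axioms by simp
    then have "(\<lambda>x. of_real (a i) * of_real x ^ i) \<in> V" for i
      by (rule L2_closed_subspace_scale[OF V(1)])
    then have "(\<lambda>x. \<Sum>i\<le>n. of_real (a i) * of_real x ^ i) \<in> V"
      by (intro L2_closed_subspace_sum[OF V(1)]) auto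
    then have pV: "(\<lambda>x. of_real (p x)) \<in> V" by (simp add: p_eq)
    have [measurable]: "p \<in> borel_measurable borel" unfolding p_eq by measurable
    have "AE x in M. (norm (complex_of_real (g x) - of_real (p x)))\<^sup>2 \<le> \<delta>\<^sup>2"
      using M(3)
    proof eventually_elim
      case (elim x)
      then have "norm (complex_of_real (g x) - of_real (p x)) \<le> \<delta>"
        using p(2)[OF elim] by (simp flip: of_real_diff)
      then show ?case by (intro power_mono) auto
    qed
    then have "(\<integral>x. (norm (complex_of_real (g x) - of_real (p x)))\<^sup>2 \<partial>M) \<le> (\<integral>x. \<delta>\<^sup>2 \<partial>M)"
      by (intro integral_mono_AE integrable_const_bound[where B="\<delta>\<^sup>2"]) auto
    also have "\<dots> < \<epsilon>" using that by (simp add: \<delta>(2) prob_space)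
    finally show ?thesis by (rule bexI[OF _ pV])
  qed
  then show ?thesis by (rule L2_closed_subspace_limit[OF V(1) L2])
qed

text \<open>Dynkin's theorem: the half-lines \<open>{..a}\<close> form an intersection-stable
  generator, and the sets with indicator in \<open>V\<close> are closed under complements and
  countable disjoint unions.\<close>

lemma indicator_in_closed_subspace:
  assumes M: "prob_space M" "sets M = sets borel" "AE x in M. x \<in> {0..1}"
    and V: "L2_closed_subspace M V" "\<And>\<xi>. expo \<xi> \<in> V"
    and A: "A \<in> sets borel"
  shows "(indicator A :: real \<Rightarrow> complex) \<in> V"
proof -
  interpret prob_space M by (rule M)
  have [measurable_cong]: "sets M = sets borel" by (rule M)
  let ?G = "range (\<lambda>a::real. {..a})"
  have sb: "sets borel = sigma_sets UNIV ?G"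
    by (subst borel_eq_atMost) (simp add: sets_measure_of)
  have st: "Int_stable ?G" by (auto simp: Int_stable_def)
  have G: "?G \<subseteq> Pow UNIV" by simp
  have "A \<in> sigma_sets UNIV ?G" using A sb by simp
  from st G this show ?thesis
  proof (induction rule: sigma_sets_induct_disjoint)
    case (basic B)
    then obtain a where B: "B = {..a}" by auto
    \<comment> \<open>For \<open>n > 0\<close> the function is 1 up to \<open>a\<close>, falls
      linearly, and is 0 from \<open>a + 1/n\<close> on.\<close>
    define g :: "nat \<Rightarrow> real \<Rightarrow> real" where "g n x = max 0 (min 1 (1 - real n * (x - a)))" for n x
    show ?case unfolding B
    proof (rule L2_closed_subspace_bounded_limit[where s="\<lambda>n x. of_real (g n x)" and K=1,
          OF finite_measure_axioms V(1)])
      show "(\<lambda>x. of_real (g n x)) \<in> V" for n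
        by (rule continuous_in_closed_subspace[OF M V]) (auto simp: g_def intro!: continuous_intros)
      have "(\<lambda>n. g n x) \<longlonglongrightarrow> indicator {..a} x" for x
      proof (cases "x \<le> a")
        case True
        then have "g n x = 1" for n by (auto simp: g_def max_def min_def mult_nonneg_nonpos)
        then show ?thesis using True by simp
      next
        case False
        then obtain n0 :: nat where n0: "1 < real n0 * (x - a)"
          using reals_Archimedean3[of "x - a"] by auto
        have "g n x = 0" if "n \<ge> n0" for n
        proof -
          have "real n0 * (x - a) \<le> real n * (x - a)" using that False by (intro mult_right_mono) auto
          then show ?thesis using n0 by (auto simp: g_def max_def min_def)
        qed
        then have "eventually (\<lambda>n. g n x = 0) sequentially" by (auto simp: eventually_sequentially)
        then show ?thesis using False by (simp add: tendsto_eventually)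
      qed
      from tendsto_of_real[OF this, where 'a=complex]
      show "AE x in M. (\<lambda>n. complex_of_real (g n x)) \<longlonglongrightarrow> indicator {..a} x"
        by (intro AE_I2) (simp only: of_real_indicator)
      show "AE x in M. norm (complex_of_real (g n x)) \<le> 1" for n
        by (auto simp: g_def max_def min_def)
    qed measurable
  next
    case empty
    have "(\<lambda>x. 0) \<in> V" using V(1) by (simp add: L2_closed_subspace_def)
    also have "(\<lambda>x. 0) = (indicator {} :: real \<Rightarrow> complex)" by auto
    finally show ?case .
  next
    case (compl B)
    have "(\<lambda>x. expo 0 x + - 1 * indicator B x) \<in> V"
      using V compl by (intro L2_closed_subspace_add L2_closed_subspace_scale)
    also have "(\<lambda>x. expo 0 x + - 1 * indicator B x) = indicator (UNIV - B)"
      by (auto simp: indicator_def)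
    finally show ?case .
  next
    case (union F)
    then have F: "F i \<in> sets borel" for i using sb by auto
    then have [measurable]: "(\<Union>i. F i) \<in> sets borel" by auto
    show ?case
    proof (rule L2_closed_subspace_bounded_limit[where s="\<lambda>n x. \<Sum>i<n. indicator (F i) x" and K=1,
          OF finite_measure_axioms V(1)])
      show "(\<lambda>x. \<Sum>i<n. indicator (F i) x) \<in> V" for n
        using union by (intro L2_closed_subspace_sum[OF V(1)]) auto
      have eq: "(\<Sum>i<n. indicator (F i) x) = (indicator (\<Union>i<n. F i) x :: complex)" for n x
        using union(1) by (intro indicator_UN_disjoint[symmetric]) (auto simp: disjoint_family_on_def)
      show "AE x in M. norm (\<Sum>i<n. indicator (F i) x :: complex) \<le> 1" for n
        unfolding eq by (auto simp: indicator_def)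
      show "AE x in M. (\<lambda>n. \<Sum>i<n. indicator (F i) x) \<longlonglongrightarrow> (indicator (\<Union>i. F i) x :: complex)"
        unfolding eq by (intro AE_I2 LIMSEQ_indicator_UN)
    qed measurable
  qed
qed

text \<open>Simple functions are combinations of indicators. They approximate \<open>f\<close>
  pointwise with norm at most \<open>2 * norm (f x)\<close>, so the squared errors are dominated by
  9 times the squared norm of \<open>f\<close>.\<close>

lemma closed_subspace_with_all_expo:
  assumes M: "prob_space M" "sets M = sets borel" "AE x in M. x \<in> {0..1}"
    and V: "L2_closed_subspace M V" "\<And>\<xi>. expo \<xi> \<in> V"
    and f: "f \<in> L2_space M"
  shows "f \<in> V"
proof -
  have [measurable]: "f \<in> borel_measurable M" and fi: "integrable M (\<lambda>x. (norm (f x))\<^sup>2)"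
    using f by (auto simp: L2_space_def)
  have simple: "s \<in> V" if s: "simple_function M s" for s :: "real \<Rightarrow> complex"
  proof -
    have spM: "space M = UNIV" using sets_eq_imp_space_eq[OF M(2)] by simp
    have "(indicator (s -` {y}) :: real \<Rightarrow> complex) \<in> V" for y
    proof (rule indicator_in_closed_subspace[OF M V])
      show "s -` {y} \<in> sets borel"
        using simple_functionD(2)[OF s, of "{y}"] by (simp add: spM M(2))
    qed
    then have "(\<lambda>x. y * indicator (s -` {y}) x) \<in> V" for y
      by (rule L2_closed_subspace_scale[OF V(1)])
    then have "(\<lambda>x. \<Sum>y\<in>s ` UNIV. y * indicator (s -` {y}) x) \<in> V"
      using simple_functionD(1)[OF s] by (intro L2_closed_subspace_sum[OF V(1)]) (auto simp: spM)
    also have "(\<lambda>x. \<Sum>y\<in>s ` UNIV. y * indicator (s -` {y}) x) = s"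
    proof
      fix x
      have fin: "finite (range s)" using simple_functionD(1)[OF s] by (simp add: spM)
      have "(\<Sum>y\<in>s ` UNIV. y * indicator (s -` {y}) x) = (\<Sum>y\<in>range s. if y = s x then y else 0)"
        by (rule sum.cong) (auto simp: indicator_def)
      then show "(\<Sum>y\<in>s ` UNIV. y * indicator (s -` {y}) x) = s x" using fin by simp
    qed
    finally show ?thesis .
  qed
  obtain s where "(\<forall>i. simple_function M (s i)) \<and> (\<forall>x\<in>space M. (\<lambda>i. s i x) \<longlonglongrightarrow> f x) \<and>
      (\<forall>i. \<forall>x\<in>space M. dist (s i x) 0 \<le> 2 * dist (f x) 0)"
    using borel_measurable_implies_sequence_metric[of f M 0] by auto
  then have s: "\<And>i. simple_function M (s i)" "\<And>x. x \<in> space M \<Longrightarrow> (\<lambda>i. s i x) \<longlonglongrightarrow> f x"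
    "\<And>i x. x \<in> space M \<Longrightarrow> norm (s i x) \<le> 2 * norm (f x)" by auto
  show ?thesis
  proof (rule L2_closed_subspace_dominated[where s=s, OF V(1) simple[OF s(1)] f])
    show "integrable M (\<lambda>x. 9 * (norm (f x))\<^sup>2)" using fi by simp
    show "AE x in M. (norm (f x - s n x))\<^sup>2 \<le> 9 * (norm (f x))\<^sup>2" for n
    proof (rule AE_I2)
      fix x assume "x \<in> space M"
      then have "norm (f x - s n x) \<le> 3 * norm (f x)"
        using norm_triangle_ineq4[of "f x" "s n x"] s(3)[of x n] by linarith
      from power_mono[OF this, of 2] show "(norm (f x - s n x))\<^sup>2 \<le> 9 * (norm (f x))\<^sup>2"
        by (simp add: power_mult_distrib)
    qed
  qed (use s(2) in auto)
qed

section \<open>Closed linear spans\<close>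

definition L2_span_closure :: "'a measure \<Rightarrow> 'i set \<Rightarrow> ('i \<Rightarrow> 'a \<Rightarrow> complex) \<Rightarrow> ('a \<Rightarrow> complex) set" where
  "L2_span_closure M I e = {f \<in> L2_space M. \<forall>\<epsilon>>0. \<exists>F c. finite F \<and> F \<subseteq> I \<and>
     (\<integral>x. (norm (f x - (\<Sum>i\<in>F. c i * e i x)))\<^sup>2 \<partial>M) < \<epsilon>}"

lemma L2_space_zero: "(\<lambda>x. 0) \<in> L2_space M"
  by (simp add: L2_space_def)

lemma L2_space_sum:
  assumes "\<And>i. i \<in> F \<Longrightarrow> f i \<in> L2_space M"
  shows "(\<lambda>x. \<Sum>i\<in>F. f i x) \<in> L2_space M"
  using assms by (induction F rule: infinite_finite_induct) (auto simp: L2_space_zero intro: L2_space_add)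

lemma L2_closed_subspace_span_closure:
  assumes e: "\<And>i. i \<in> I \<Longrightarrow> e i \<in> L2_space M"
  shows "L2_closed_subspace M (L2_span_closure M I e)"
proof -
  have comb: "(\<lambda>x. \<Sum>i\<in>F. c i * e i x) \<in> L2_space M" if "F \<subseteq> I" for F c
    using that by (intro L2_space_sum L2_space_scale e) auto
  have zero: "(\<lambda>x. 0) \<in> L2_span_closure M I e"
    unfolding L2_span_closure_def by (auto simp: L2_space_zero intro!: exI[of _ "{}"])
  have add: "(\<lambda>x. f x + g x) \<in> L2_span_closure M I e"
    if f: "f \<in> L2_span_closure M I e" and g: "g \<in> L2_span_closure M I e" for f g
  proof -
    have L2: "f \<in> L2_space M" "g \<in> L2_space M" using f g by (auto simp: L2_span_closure_def)
    have "\<exists>F c. finite F \<and> F \<subseteq> I \<and> (\<integral>x. (norm (f x + g x - (\<Sum>i\<in>F. c i * e i x)))\<^sup>2 \<partial>M) < \<epsilon>"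
      if "\<epsilon> > 0" for \<epsilon>
    proof -
      \<comment> \<open>The quarter offsets the factor 2 in \<open>L2_integral_add_le\<close> and
        the two summands.\<close>
      have "\<epsilon> / 4 > 0" using that by simp
      then obtain F c G d where F: "finite F" "F \<subseteq> I" "(\<integral>x. (norm (f x - (\<Sum>i\<in>F. c i * e i x)))\<^sup>2 \<partial>M) < \<epsilon> / 4"
        and G: "finite G" "G \<subseteq> I" "(\<integral>x. (norm (g x - (\<Sum>i\<in>G. d i * e i x)))\<^sup>2 \<partial>M) < \<epsilon> / 4"
        using f g unfolding L2_span_closure_def by blast
      define h where "h i = (if i \<in> F then c i else 0) + (if i \<in> G then d i else 0)" for i
      have "(\<Sum>i\<in>F \<union> G. h i * e i x) = (\<Sum>i\<in>F. c i * e i x) + (\<Sum>i\<in>G. d i * e i x)" for x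
      proof -
        have "(\<Sum>i\<in>F. c i * e i x) = (\<Sum>i\<in>F \<union> G. (if i \<in> F then c i else 0) * e i x)"
          using F G by (intro sum.mono_neutral_cong_left) auto
        moreover have "(\<Sum>i\<in>G. d i * e i x) = (\<Sum>i\<in>F \<union> G. (if i \<in> G then d i else 0) * e i x)"
          using F G by (intro sum.mono_neutral_cong_left) auto
        ultimately show ?thesis by (simp add: h_def distrib_right sum.distrib)
      qed
      then have eq: "f x + g x - (\<Sum>i\<in>F \<union> G. h i * e i x)
          = (f x - (\<Sum>i\<in>F. c i * e i x)) + (g x - (\<Sum>i\<in>G. d i * e i x))" for x by simp
      have "(\<integral>x. (norm (f x + g x - (\<Sum>i\<in>F \<union> G. h i * e i x)))\<^sup>2 \<partial>M) < \<epsilon>"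
        unfolding eq using L2_integral_add_le[OF L2_space_diff[OF L2(1) comb[OF F(2)]] L2_space_diff[OF L2(2) comb[OF G(2)]], of c d]
          F(3) G(3) by simp
      then show ?thesis using F G by (intro exI[of _ "F \<union> G"] exI[of _ h]) auto
    qed
    then show ?thesis using L2_space_add[OF L2] by (simp add: L2_span_closure_def)
  qed
  have scale: "(\<lambda>x. a * f x) \<in> L2_span_closure M I e" if f: "f \<in> L2_span_closure M I e" for a f
  proof -
    have L2: "f \<in> L2_space M" using f by (auto simp: L2_span_closure_def)
    have "\<exists>F c. finite F \<and> F \<subseteq> I \<and> (\<integral>x. (norm (a * f x - (\<Sum>i\<in>F. c i * e i x)))\<^sup>2 \<partial>M) < \<epsilon>"
      if "\<epsilon> > 0" for \<epsilon>
    proof -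
      \<comment> \<open>The summand 1 covers the case \<open>a = 0\<close>.\<close>
      have *: "\<epsilon> / ((norm a)\<^sup>2 + 1) > 0" using that by (simp add: add_nonneg_pos)
      then obtain F c where F: "finite F" "F \<subseteq> I"
        "(\<integral>x. (norm (f x - (\<Sum>i\<in>F. c i * e i x)))\<^sup>2 \<partial>M) < \<epsilon> / ((norm a)\<^sup>2 + 1)"
        using f unfolding L2_span_closure_def by blast
      let ?J = "\<integral>x. (norm (f x - (\<Sum>i\<in>F. c i * e i x)))\<^sup>2 \<partial>M"
      have "a * f x - (\<Sum>i\<in>F. (a * c i) * e i x) = a * (f x - (\<Sum>i\<in>F. c i * e i x))" for x
        by (simp add: right_diff_distrib sum_distrib_left mult.assoc)
      then have "(\<integral>x. (norm (a * f x - (\<Sum>i\<in>F. (a * c i) * e i x)))\<^sup>2 \<partial>M) = (norm a)\<^sup>2 * ?J"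
        by (simp add: norm_mult power_mult_distrib)
      also have "\<dots> \<le> ((norm a)\<^sup>2 + 1) * ?J" by (intro mult_right_mono) auto
      also have "\<dots> < \<epsilon>" using F(3) by (simp add: pos_less_divide_eq add_nonneg_pos mult.commute)
      finally show ?thesis using F by (intro exI[of _ F] exI[of _ "\<lambda>i. a * c i"]) auto
    qed
    then show ?thesis using L2_space_scale[OF L2] by (simp add: L2_span_closure_def)
  qed
  have limit: "f \<in> L2_span_closure M I e"
    if f: "f \<in> L2_space M" and lim: "\<forall>\<epsilon>>0. \<exists>g\<in>L2_span_closure M I e. (\<integral>x. (norm (f x - g x))\<^sup>2 \<partial>M) < \<epsilon>" for f
  proof -
    have "\<exists>F c. finite F \<and> F \<subseteq> I \<and> (\<integral>x. (norm (f x - (\<Sum>i\<in>F. c i * e i x)))\<^sup>2 \<partial>M) < \<epsilon>"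
      if "\<epsilon> > 0" for \<epsilon>
    proof -
      have "\<epsilon> / 4 > 0" using that by simp
      then obtain g where g: "g \<in> L2_span_closure M I e" "(\<integral>x. (norm (f x - g x))\<^sup>2 \<partial>M) < \<epsilon> / 4"
        using lim by meson
      have gL: "g \<in> L2_space M" using g by (simp add: L2_span_closure_def)
      obtain F c where F: "finite F" "F \<subseteq> I" "(\<integral>x. (norm (g x - (\<Sum>i\<in>F. c i * e i x)))\<^sup>2 \<partial>M) < \<epsilon> / 4"
        using g(1) \<open>\<epsilon> / 4 > 0\<close> unfolding L2_span_closure_def by blast
      have "(\<integral>x. (norm (f x - (\<Sum>i\<in>F. c i * e i x)))\<^sup>2 \<partial>M) < \<epsilon>"
        using L2_integral_add_le[OF L2_space_diff[OF f gL] L2_space_diff[OF gL comb[OF F(2)]], of c]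
          F(3) g(2) by simp
      then show ?thesis using F by blast
    qed
    then show ?thesis using f by (simp add: L2_span_closure_def)
  qed
  show ?thesis
    unfolding L2_closed_subspace_def using zero add scale limit by (auto simp: L2_span_closure_def)
qed

section \<open>Orthonormal bases of exponentials\<close>

definition ft :: "real measure \<Rightarrow> real \<Rightarrow> complex" where
  "ft M \<xi> = (\<integral>x. expo \<xi> x \<partial>M)"

lemma ft_eq_char: "ft M \<xi> = char M (- 2 * pi * \<xi>)"
  unfolding ft_def char_def expo_eq_iexp by simp

lemma L2_inner_expo: "L2_inner M (expo l) (expo l') = ft M (l - l')"
  unfolding L2_inner_def ft_def cnj_expo by (simp flip: expo_add)

lemma ft_uminus: "ft M (- \<xi>) = cnj (ft M \<xi>)"
proof -
  have "expo (- \<xi>) = (\<lambda>x. cnj (expo \<xi> x))" by (simp add: cnj_expo)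
  then show ?thesis by (simp add: ft_def)
qed

lemma norm_ft_uminus: "norm (ft M (- \<xi>)) = norm (ft M \<xi>)"
  by (simp add: ft_uminus)

context
  fixes M :: "real measure"
  assumes prob: "prob_space M" and sM [measurable_cong]: "sets M = sets borel"
begin

interpretation prob_space M by (rule prob)

lemma ft_0: "ft M 0 = 1"
  by (simp add: ft_def prob_space)

lemma integrable_expo: "integrable M (expo l)"
  by (rule integrable_const_bound[where B=1]) auto

lemma expo_in_L2: "expo l \<in> L2_space M"
  by (rule L2_space_AE_bounded[where K=1]) (auto intro: finite_measure_axioms)

text \<open>The error of approximating \<open>expo \<xi>\<close> by a finite combination, tested
  against \<open>expo \<eta>\<close>; used both for Parseval's identity and for refuting
  completeness.\<close>

lemma integral_expo_residual:
  fixes c :: "real \<Rightarrow> complex" and \<xi> \<eta> :: real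
  assumes "finite F"
  defines "u \<equiv> (\<lambda>x. expo \<xi> x - (\<Sum>l\<in>F. c l * expo l x))"
  shows "integrable M (\<lambda>x. u x * expo (- \<eta>) x)"
    and "(\<integral>x. u x * expo (- \<eta>) x \<partial>M) = ft M (\<xi> - \<eta>) - (\<Sum>l\<in>F. c l * ft M (l - \<eta>))"
proof -
  have eq: "u x * expo (- \<eta>) x = expo (\<xi> - \<eta>) x - (\<Sum>l\<in>F. c l * expo (l - \<eta>) x)" for x
    using expo_add[of _ "- \<eta>"] by (simp add: u_def left_diff_distrib sum_distrib_right mult.assoc)
  show "integrable M (\<lambda>x. u x * expo (- \<eta>) x)"
    unfolding eq using integrable_expo by auto
  show "(\<integral>x. u x * expo (- \<eta>) x \<partial>M) = ft M (\<xi> - \<eta>) - (\<Sum>l\<in>F. c l * ft M (l - \<eta>))"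
    unfolding eq ft_def using integrable_expo by simp
qed

text \<open>The coefficients are the inner products of \<open>expo \<xi>\<close> with the
  \<open>expo l\<close>, so the residual is orthogonal to every \<open>expo l\<close>, and its
  squared norm equals its inner product with \<open>expo \<xi>\<close>.\<close>

lemma Parseval_expo:
  assumes F: "finite F" and orth: "\<And>l l'. l \<in> F \<Longrightarrow> l' \<in> F \<Longrightarrow> l \<noteq> l' \<Longrightarrow> ft M (l - l') = 0"
  shows "(\<integral>x. (norm (expo \<xi> x - (\<Sum>l\<in>F. ft M (\<xi> - l) * expo l x)))\<^sup>2 \<partial>M)
    = 1 - (\<Sum>l\<in>F. (norm (ft M (\<xi> - l)))\<^sup>2)"
proof -
  define c where "c l = ft M (\<xi> - l)" for l
  define u where "u x = expo \<xi> x - (\<Sum>l\<in>F. c l * expo l x)" for x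
  note res = integral_expo_residual[OF F, of \<xi> c, folded u_def]
  have u_orth: "(\<integral>x. u x * expo (- \<eta>) x \<partial>M) = 0" if "\<eta> \<in> F" for \<eta>
  proof -
    have "(\<Sum>l\<in>F. c l * ft M (l - \<eta>)) = (\<Sum>l\<in>F. if l = \<eta> then c \<eta> else 0)"
      using orth that by (intro sum.cong) (auto simp: ft_0)
    then show ?thesis using F that by (simp add: res c_def)
  qed
  have "complex_of_real ((norm (u x))\<^sup>2) = u x * expo (- \<xi>) x - (\<Sum>l\<in>F. cnj (c l) * (u x * expo (- l) x))" for x
  proof -
    have "complex_of_real ((norm (u x))\<^sup>2) = u x * cnj (u x)" by (rule complex_norm_square)
    also have "cnj (u x) = expo (- \<xi>) x - (\<Sum>l\<in>F. cnj (c l) * expo (- l) x)"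
      by (simp add: u_def cnj_expo)
    finally show ?thesis by (simp add: right_diff_distrib sum_distrib_left algebra_simps)
  qed
  then have "complex_of_real (\<integral>x. (norm (u x))\<^sup>2 \<partial>M)
      = (\<integral>x. u x * expo (- \<xi>) x - (\<Sum>l\<in>F. cnj (c l) * (u x * expo (- l) x)) \<partial>M)"
    by (simp flip: integral_complex_of_real)
  also have "\<dots> = (\<integral>x. u x * expo (- \<xi>) x \<partial>M) - (\<Sum>l\<in>F. cnj (c l) * (\<integral>x. u x * expo (- l) x \<partial>M))"
    using res(1) by simp
  also have "\<dots> = 1 - (\<Sum>l\<in>F. c l * ft M (- (\<xi> - l)))" using u_orth by (simp add: res(2) ft_0)
  also have "\<dots> = 1 - (\<Sum>l\<in>F. of_real ((norm (c l))\<^sup>2))"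
    unfolding ft_uminus c_def complex_norm_square ..
  also have "\<dots> = complex_of_real (1 - (\<Sum>l\<in>F. (norm (c l))\<^sup>2))" by simp
  finally show ?thesis unfolding of_real_eq_iff u_def c_def .
qed

lemma Bessel_expo:
  assumes "finite F" "\<And>l l'. l \<in> F \<Longrightarrow> l' \<in> F \<Longrightarrow> l \<noteq> l' \<Longrightarrow> ft M (l - l') = 0"
  shows "(\<Sum>l\<in>F. (norm (ft M (\<xi> - l)))\<^sup>2) \<le> 1"
proof -
  have "0 \<le> (\<integral>x. (norm (expo \<xi> x - (\<Sum>l\<in>F. ft M (\<xi> - l) * expo l x)))\<^sup>2 \<partial>M)" by simp
  then show ?thesis using Parseval_expo[OF assms, of \<xi>] by simp
qed

text \<open>By Parseval, \<open>total\<close> puts every exponential, of arbitrary real frequency,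
  into the closed span of the family; density of the exponentials does the rest.\<close>

lemma orthonormal_basis_expo:
  assumes supp: "AE x in M. x \<in> {0..1}"
    and orth: "\<And>l l'. l \<in> I \<Longrightarrow> l' \<in> I \<Longrightarrow> l \<noteq> l' \<Longrightarrow> ft M (l - l') = 0"
    and total: "\<And>\<xi> \<epsilon>. \<epsilon> > 0 \<Longrightarrow> \<exists>F. finite F \<and> F \<subseteq> I \<and> 1 - \<epsilon> < (\<Sum>l\<in>F. (norm (ft M (\<xi> - l)))\<^sup>2)"
  shows "orthonormal_basis_L2 M I expo"
proof -
  have V: "L2_closed_subspace M (L2_span_closure M I expo)"
    by (intro L2_closed_subspace_span_closure expo_in_L2)
  have expoV: "expo \<xi> \<in> L2_span_closure M I expo" for \<xi>
    unfolding L2_span_closure_def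
  proof (safe intro!: expo_in_L2)
    fix \<epsilon> :: real assume "\<epsilon> > 0"
    then obtain F where F: "finite F" "F \<subseteq> I" "1 - \<epsilon> < (\<Sum>l\<in>F. (norm (ft M (\<xi> - l)))\<^sup>2)"
      using total by blast
    have "(\<integral>x. (norm (expo \<xi> x - (\<Sum>l\<in>F. ft M (\<xi> - l) * expo l x)))\<^sup>2 \<partial>M) < \<epsilon>"
      by (subst Parseval_expo) (use F orth in auto)
    then show "\<exists>F c. finite F \<and> F \<subseteq> I \<and> (\<integral>x. (norm (expo \<xi> x - (\<Sum>l\<in>F. c l * expo l x)))\<^sup>2 \<partial>M) < \<epsilon>"
      using F by (intro exI[of _ F] exI[of _ "\<lambda>l. ft M (\<xi> - l)"]) auto
  qed
  have "\<exists>F c. finite F \<and> F \<subseteq> I \<and> L2_norm M (\<lambda>x. f x - (\<Sum>i\<in>F. c i * expo i x)) < \<epsilon>"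
    if f: "f \<in> L2_space M" and "\<epsilon> > 0" for f \<epsilon>
  proof -
    have "f \<in> L2_span_closure M I expo"
      by (rule closed_subspace_with_all_expo[OF prob sM supp V expoV f])
    moreover have "\<epsilon>\<^sup>2 > 0" using \<open>\<epsilon> > 0\<close> by simp
    ultimately show ?thesis
      unfolding L2_span_closure_def L2_norm_less_iff[OF \<open>\<epsilon> > 0\<close>] by blast
  qed
  then show ?thesis
    unfolding orthonormal_basis_L2_def L2_inner_expo using expo_in_L2 orth ft_0 by auto
qed

text \<open>\<open>expo \<eta>\<close> is a unit vector orthogonal to the whole family, so no finite
  combination comes closer to it than distance 1.\<close>

lemma not_orthonormal_basis_expo:
  assumes "\<And>l. l \<in> I \<Longrightarrow> ft M (l - \<eta>) = 0"
  shows "\<not> orthonormal_basis_L2 M I expo"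
proof
  assume "orthonormal_basis_L2 M I expo"
  then have "\<exists>F c. finite F \<and> F \<subseteq> I \<and> L2_norm M (\<lambda>x. expo \<eta> x - (\<Sum>i\<in>F. c i * expo i x)) < 1"
    unfolding orthonormal_basis_L2_def using expo_in_L2[of \<eta>] zero_less_one by blast
  then obtain F c where F: "finite F" "F \<subseteq> I" "L2_norm M (\<lambda>x. expo \<eta> x - (\<Sum>i\<in>F. c i * expo i x)) < 1"
    by blast
  define u where "u x = expo \<eta> x - (\<Sum>l\<in>F. c l * expo l x)" for x
  note res = integral_expo_residual[OF F(1), of \<eta> c, folded u_def]
  have small: "(\<integral>x. (norm (u x))\<^sup>2 \<partial>M) < 1" using F(3) by (simp add: L2_norm_less_iff u_def)
  have "(\<Sum>l\<in>F. c l * ft M (l - \<eta>)) = 0" using assms F(2) by (intro sum.neutral) auto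
  then have one: "(\<integral>x. u x * expo (- \<eta>) x \<partial>M) = 1" by (simp add: res(2) ft_0)
  have "u \<in> L2_space M"
    unfolding u_def by (intro L2_space_diff L2_space_sum L2_space_scale expo_in_L2)
  then have iu: "integrable M (\<lambda>x. (norm (u x))\<^sup>2)" by (simp add: L2_space_def)
  define r where "r x = Re (u x * expo (- \<eta>) x)" for x
  have r: "integrable M r" "(\<integral>x. r x \<partial>M) = 1"
    unfolding r_def using integrable_Re[OF res(1)] integral_Re[OF res(1)] one by simp_all
  \<comment> \<open>Integrating this pointwise inequality replaces Cauchy-Schwarz: it yields
    \<open>1 \<le> \<integral> (norm u)^2\<close> from \<open>\<integral> r = 1\<close>.\<close>
  have "2 * r x - 1 \<le> (norm (u x))\<^sup>2" for x
  proof -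
    have "r x \<le> norm (u x)"
      using complex_Re_le_cmod[of "u x * expo (- \<eta>) x"] by (simp add: norm_mult r_def)
    moreover have "0 \<le> (norm (u x) - 1)\<^sup>2" by simp
    ultimately show ?thesis by (simp add: power2_eq_square algebra_simps)
  qed
  then have "(\<integral>x. 2 * r x - 1 \<partial>M) \<le> (\<integral>x. (norm (u x))\<^sup>2 \<partial>M)"
    using iu r(1) by (intro integral_mono) auto
  moreover have "(\<integral>x. 2 * r x - 1 \<partial>M) = 1"
    using r by (simp add: prob_space)
  ultimately show False using small by simp
qed

end

section \<open>Digit expansions and the refinement equation\<close>

lemma expo_eq_1_iff: "expo l x = 1 \<longleftrightarrow> l * x \<in> \<int>"
proof -
  have "expo l x = 1 \<longleftrightarrow> (\<exists>n::int. - 2 * pi * l * x = of_int (2 * n) * pi)"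
    unfolding expo_eq_iexp exp_eq_1 by simp
  also have "\<dots> \<longleftrightarrow> (\<exists>n::int. l * x = of_int (- n))"
  proof -
    have "- 2 * pi * l * x = of_int (2 * n) * pi \<longleftrightarrow> l * x = of_int (- n)" for n :: int
    proof -
      have "- 2 * pi * l * x - of_int (2 * n) * pi = - 2 * pi * (l * x + of_int n)"
        by (simp add: algebra_simps)
      then have "- 2 * pi * l * x = of_int (2 * n) * pi \<longleftrightarrow> - 2 * pi * (l * x + of_int n) = 0"
        by (simp only: eq_iff_diff_eq_0[of "- 2 * pi * l * x"])
      also have "\<dots> \<longleftrightarrow> l * x + of_int n = 0" by simp
      finally show ?thesis by (auto simp: add_eq_0_iff2)
    qed
    then show ?thesis by simp
  qed
  also have "\<dots> \<longleftrightarrow> l * x \<in> \<int>"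
    by (metis Ints_cases Ints_of_int minus_minus)
  finally show ?thesis .
qed

lemma expo_cong: "l * x = l' * x' \<Longrightarrow> expo l x = expo l' x'"
  unfolding expo_eq_iexp by (simp only: mult.assoc)

lemma expo_power: "expo l x ^ n = expo (of_nat n * l) x"
  by (induction n) (simp_all add: expo_add distrib_right)

lemma expo_add_right: "expo l (x + y) = expo l x * expo l y"
  by (simp add: expo_def exp_add[symmetric] algebra_simps)

lemma expo_int_shift: "l * y \<in> \<int> \<Longrightarrow> expo l (x + y) = expo l x"
  using expo_eq_1_iff[of l y] by (simp add: expo_add_right)

lemma geometric_roots_of_unity:
  fixes z :: complex
  assumes "z ^ n = 1" "z \<noteq> 1"
  shows "(\<Sum>d<n. z ^ d) = 0"
  using geometric_sum[OF assms(2), of n] assms(1) by simp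

text \<open>Works with any self-similar measure carried by the unit interval; existence and
  uniqueness identify it with \<open>self_similar_measure\<close> at the very end.\<close>

locale cantor_measure =
  fixes N q b :: nat and M :: "real measure"
  assumes N: "2 \<le> N" and q: "2 \<le> q" and b: "b = q * N"
    and self_similar: "is_self_similar_measure (real b) ((\<lambda>d. real q * d) ` real ` {0..N - 1}) M"
    and supp: "AE x in M. x \<in> {0..1}"
begin

sublocale real_distribution M
  using self_similar by (rule real_distribution_self_similar)

lemma sets_M: "sets M = sets borel" and prob_M: "prob_space M"
  using self_similar by (auto simp: is_self_similar_measure_def)

section \<open>Integers with a given number of digits\<close>

lemma b_ge: "b \<ge> 4" "b \<ge> 2 * N"
  using mult_le_mono[OF q N] mult_le_mono[OF q order_refl[of N]] b by auto

lemma b_pos [simp]: "b > 0" "b \<noteq> 0" using b_ge by auto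

text \<open>The set \<open>\<C>\<close> as integers. The rounded lower end expresses the strict
  bound \<open>- N/2 < c\<close>, that is, \<open>2 * c \<ge> - (N - 1)\<close>.\<close>

definition digs :: "int set" where
  "digs = {- ((int N - 1) div 2) .. int N div 2}"

lemma finite_digs [simp]: "finite digs" by (simp add: digs_def)

lemma zero_digs: "0 \<in> digs" and one_digs: "1 \<in> digs"
  using N by (auto simp: digs_def)

lemma digs_eq: "digs = (\<lambda>i. int i - (int N - 1) div 2) ` {..<N}"
proof
  show "digs \<subseteq> (\<lambda>i. int i - (int N - 1) div 2) ` {..<N}"
  proof
    fix c assume "c \<in> digs"
    then show "c \<in> (\<lambda>i. int i - (int N - 1) div 2) ` {..<N}"
      by (intro image_eqI[of _ _ "nat (c + (int N - 1) div 2)"]) (auto simp: digs_def)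
  qed
  show "(\<lambda>i. int i - (int N - 1) div 2) ` {..<N} \<subseteq> digs" by (auto simp: digs_def)
qed

lemma digs_diff: "c \<in> digs \<Longrightarrow> c' \<in> digs \<Longrightarrow> c \<noteq> c' \<Longrightarrow> \<not> int N dvd c - c'"
proof
  assume c: "c \<in> digs" "c' \<in> digs" "c \<noteq> c'" and "int N dvd c - c'"
  then have "\<bar>int N\<bar> \<le> \<bar>c - c'\<bar>" by (intro dvd_imp_le_int) auto
  then show False using c by (auto simp: digs_def)
qed

lemma digs_bounds:
  assumes "c \<in> digs"
  shows "- (int N - 1) \<le> 2 * c" "2 * c \<le> int N"
  using assms by (auto simp: digs_def)

text \<open>Integers with \<open>n\<close> base-\<open>b\<close> digits from \<open>digs\<close>,
  built from the least significant digit. As 0 is a digit, the sets increase with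
  \<open>n\<close>.\<close>

fun dig :: "nat \<Rightarrow> int set" where
  "dig 0 = {0}"
| "dig (Suc n) = (\<lambda>(c, l). c + int b * l) ` (digs \<times> dig n)"

lemma finite_dig [simp]: "finite (dig n)" by (induction n) auto

lemma dig_SucI: "c \<in> digs \<Longrightarrow> l \<in> dig n \<Longrightarrow> c + int b * l \<in> dig (Suc n)"
  by auto

lemma zero_dig: "0 \<in> dig n"
proof (induction n)
  case (Suc n)
  then show ?case using dig_SucI[OF zero_digs Suc] by simp
qed simp

lemma dig_mono: "m \<le> n \<Longrightarrow> dig m \<subseteq> dig n"
proof (induction m arbitrary: n)
  case (Suc m)
  then obtain n' where n: "n = Suc n'" "m \<le> n'" by (cases n) auto
  show ?case using Suc.IH[OF n(2)] unfolding n(1) by auto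
qed (simp add: zero_dig)

lemma dig_append: "s \<in> dig m \<Longrightarrow> y \<in> dig n \<Longrightarrow> s + int b ^ m * y \<in> dig (m + n)"
proof (induction m arbitrary: s)
  case (Suc m)
  then obtain c l where s: "s = c + int b * l" "c \<in> digs" "l \<in> dig m" by auto
  have "c + int b * (l + int b ^ m * y) \<in> dig (Suc (m + n))"
    by (rule dig_SucI[OF s(2) Suc.IH[OF s(3) Suc.prems(2)]])
  then show ?case by (simp add: s(1) algebra_simps)
qed simp

text \<open>Splits off the most significant digit, at the opposite end from the recursion of
  \<open>dig\<close>.\<close>

lemma dig_Suc_last:
  assumes "x \<in> dig (Suc n)"
  obtains y c where "y \<in> dig n" "c \<in> digs" "x = y + int b ^ n * c"
proof -
  have "\<exists>y\<in>dig n. \<exists>c\<in>digs. x = y + int b ^ n * c"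
    using assms
  proof (induction n arbitrary: x)
    case (Suc n)
    then obtain c l where x: "x = c + int b * l" "c \<in> digs" "l \<in> dig (Suc n)"
      by (auto simp del: dig.simps(2) simp: dig.simps(2)[of "Suc n"])
    obtain y c' where y: "y \<in> dig n" "c' \<in> digs" "l = y + int b ^ n * c'"
      using Suc.IH[OF x(3)] by blast
    have "c + int b * y \<in> dig (Suc n)" by (rule dig_SucI[OF x(2) y(1)])
    moreover have "x = (c + int b * y) + int b ^ Suc n * c'"
      by (simp add: x y algebra_simps)
    ultimately show ?case using y(2) by blast
  qed auto
  then show thesis using that by blast
qed

text \<open>Take \<open>j\<close> to be the lowest position where the digits differ: there the
  difference is nonzero modulo \<open>N\<close>, and all higher positions contribute multiples of
  \<open>b\<close>, hence of \<open>N\<close>.\<close>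

lemma dig_diff:
  assumes "x \<in> dig n" "y \<in> dig n" "x \<noteq> y"
  obtains j k where "j < n" "x - y = int b ^ j * k" "\<not> int N dvd k"
proof -
  have "\<exists>j k. j < n \<and> x - y = int b ^ j * k \<and> \<not> int N dvd k"
    using assms
  proof (induction n arbitrary: x y)
    case (Suc n)
    then obtain c l c' l' where x: "x = c + int b * l" "c \<in> digs" "l \<in> dig n"
      and y: "y = c' + int b * l'" "c' \<in> digs" "l' \<in> dig n" by auto
    show ?case
    proof (cases "c = c'")
      case True
      with Suc.prems x y have "l \<noteq> l'" by auto
      from Suc.IH[OF x(3) y(3) this] obtain j k where jk: "j < n" "l - l' = int b ^ j * k" "\<not> int N dvd k"
        by blast
      have "x - y = int b * (l - l')" using x y True by (simp add: algebra_simps)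
      then have "x - y = int b ^ Suc j * k" by (simp add: jk)
      then show ?thesis using jk by blast
    next
      case False
      have "int N dvd int b * (l - l')" by (simp add: b)
      then have "\<not> int N dvd (c - c') + int b * (l - l')"
        using digs_diff[OF x(2) y(2) False] dvd_add_left_iff by blast
      then show ?thesis using x y by (intro exI[of _ 0] exI[of _ "x - y"]) (simp add: algebra_simps)
    qed
  qed simp
  then show thesis using that by blast
qed

text \<open>Geometric sums with all digits at most \<open>N/2\<close> and at least
  \<open>-(N - 1)/2\<close>, multiplied by \<open>2 * (b - 1)\<close> to remain in the
  integers.\<close>

lemma dig_bounds:
  assumes "x \<in> dig n"
  shows "2 * (int b - 1) * x \<le> int N * (int b ^ n - 1)"
    and "- (int N - 1) * (int b ^ n - 1) \<le> 2 * (int b - 1) * x"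
proof -
  have "2 * (int b - 1) * x \<le> int N * (int b ^ n - 1) \<and> - (int N - 1) * (int b ^ n - 1) \<le> 2 * (int b - 1) * x"
    using assms
  proof (induction n arbitrary: x)
    case (Suc n)
    then obtain c l where x: "x = c + int b * l" "c \<in> digs" "l \<in> dig n" by auto
    have l: "int b * (2 * (int b - 1) * l) \<le> int b * (int N * (int b ^ n - 1))"
      "int b * (- (int N - 1) * (int b ^ n - 1)) \<le> int b * (2 * (int b - 1) * l)"
      using Suc.IH[OF x(3)] by (intro mult_left_mono; simp)+
    have c: "(int b - 1) * (2 * c) \<le> (int b - 1) * int N"
      "(int b - 1) * (- (int N - 1)) \<le> (int b - 1) * (2 * c)"
      using digs_bounds[OF x(2)] b_ge by (intro mult_left_mono; simp)+
    show ?case using l c unfolding x by (simp add: algebra_simps)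
  qed simp
  then show "2 * (int b - 1) * x \<le> int N * (int b ^ n - 1)"
    "- (int N - 1) * (int b ^ n - 1) \<le> 2 * (int b - 1) * x" by auto
qed

lemma digs_iff: "real_of_int c \<in> {- (real N / 2)<..real N / 2} \<inter> \<int> \<longleftrightarrow> c \<in> digs"
proof -
  have "real_of_int c \<le> real N / 2 \<longleftrightarrow> 2 * c \<le> int N" by linarith
  moreover have "- (real N / 2) < real_of_int c \<longleftrightarrow> - int N < 2 * c" by linarith
  ultimately show ?thesis by (auto simp: digs_def)
qed

lemma digit_expansions_eq:
  "digit_expansions (real b) ({- (real N / 2)<..real N / 2} \<inter> \<int>) = real_of_int ` (\<Union>n. dig n)"
proof (intro equalityI subsetI)
  fix x assume "x \<in> digit_expansions (real b) ({- (real N / 2)<..real N / 2} \<inter> \<int>)"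
  then obtain n c where x: "x = (\<Sum>k=0..n. real b ^ k * c k)"
    and c: "\<And>k. k \<le> n \<Longrightarrow> c k \<in> {- (real N / 2)<..real N / 2} \<inter> \<int>"
    by (auto simp: digit_expansions_def)
  have fl: "real_of_int \<lfloor>c k\<rfloor> = c k" "\<lfloor>c k\<rfloor> \<in> digs" if "k \<le> n" for k
    using c[OF that] digs_iff[of "\<lfloor>c k\<rfloor>"] by (auto elim!: Ints_cases)
  have "m \<le> n \<Longrightarrow> \<exists>l\<in>dig (Suc m). (\<Sum>k=0..m. real b ^ k * c k) = real_of_int l" for m
  proof (induction m)
    case 0
    have "\<lfloor>c 0\<rfloor> + int b * 0 \<in> dig (Suc 0)" using fl[of 0] by (intro dig_SucI) auto
    then show ?case using fl[of 0] by (intro bexI[of _ "\<lfloor>c 0\<rfloor>"]) auto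
  next
    case (Suc m)
    then have "\<exists>l\<in>dig (Suc m). (\<Sum>k=0..m. real b ^ k * c k) = real_of_int l" by (simp del: dig.simps)
    then obtain l where l: "l \<in> dig (Suc m)" "(\<Sum>k=0..m. real b ^ k * c k) = real_of_int l" by blast
    have "\<lfloor>c (Suc m)\<rfloor> + int b * 0 \<in> dig (Suc 0)" using fl[of "Suc m"] Suc.prems by (intro dig_SucI) auto
    from dig_append[OF l(1) this] have "l + int b ^ Suc m * \<lfloor>c (Suc m)\<rfloor> \<in> dig (Suc (Suc m))" by simp
    moreover have "(\<Sum>k=0..Suc m. real b ^ k * c k) = real_of_int (l + int b ^ Suc m * \<lfloor>c (Suc m)\<rfloor>)"
      using l(2) by (simp add: fl(1)[OF Suc.prems])
    ultimately show ?case by blast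
  qed
  then show "x \<in> real_of_int ` (\<Union>n. dig n)" using x by blast
next
  fix x assume "x \<in> real_of_int ` (\<Union>n. dig n)"
  then obtain n l where "x = real_of_int l" "l \<in> dig n" by auto
  \<comment> \<open>An expansion with top index \<open>n\<close> has \<open>n + 1\<close> digits, at
    least one; padding by a zero digit also handles \<open>dig 0\<close>.\<close>
  then have l: "x = real_of_int l" "l \<in> dig (Suc n)" using dig_mono[of n "Suc n"] by auto
  have "l \<in> dig (Suc m) \<Longrightarrow> \<exists>c. (\<forall>k\<le>m. c k \<in> digs) \<and> l = (\<Sum>k=0..m. int b ^ k * c k)" for m l
  proof (induction m arbitrary: l)
    case 0
    then show ?case by (auto intro!: exI[of _ "\<lambda>_. l"])
  next
    case (Suc m)
    obtain y c where y: "y \<in> dig (Suc m)" "c \<in> digs" "l = y + int b ^ Suc m * c"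
      using Suc.prems by (rule dig_Suc_last)
    from Suc.IH[OF y(1)] obtain c' where c': "\<forall>k\<le>m. c' k \<in> digs" "y = (\<Sum>k=0..m. int b ^ k * c' k)" by blast
    have "(\<Sum>k=0..m. int b ^ k * c' k) = (\<Sum>k=0..m. int b ^ k * (c'(Suc m := c)) k)"
      by (rule sum.cong) auto
    then have "l = (\<Sum>k=0..Suc m. int b ^ k * (c'(Suc m := c)) k)" using y(3) c'(2) by simp
    moreover have "\<forall>k\<le>Suc m. (c'(Suc m := c)) k \<in> digs" using c'(1) y(2) by (auto simp: le_Suc_eq)
    ultimately show ?case by blast
  qed
  from this[OF l(2)] obtain c where c: "\<forall>k\<le>n. c k \<in> digs" "l = (\<Sum>k=0..n. int b ^ k * c k)" by blast
  have "x = (\<Sum>k=0..n. real b ^ k * real_of_int (c k))" by (simp add: l(1) c(2))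
  moreover have "\<forall>k\<le>n. real_of_int (c k) \<in> {- (real N / 2)<..real N / 2} \<inter> \<int>"
    using c(1) digs_iff by blast
  ultimately show "x \<in> digit_expansions (real b) ({- (real N / 2)<..real N / 2} \<inter> \<int>)"
    unfolding digit_expansions_def by (intro CollectI exI[of _ n] exI[of _ "\<lambda>k. real_of_int (c k)"]) simp
qed

section \<open>The mask and the refinement equation\<close>

definition mask :: "real \<Rightarrow> complex" where
  "mask y = (\<Sum>d<N. expo (real q) y ^ d) / of_nat N"

lemma ft_refine: "ft M \<xi> = mask (\<xi> / real b) * ft M (\<xi> / real b)"
proof -
  let ?B = "(\<lambda>d. real q * d) ` real ` {0..N - 1}"
  have B: "?B = (\<lambda>d. real q * real d) ` {..<N}" using N by (auto simp: image_image lessThan_atLeast0 less_eq_Suc_le)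
  have inj: "inj_on (\<lambda>d. real q * real d) {..<N}" using q by (auto simp: inj_on_def)
  have "ft M \<xi> = (\<Sum>a\<in>?B. iexp (- 2 * pi * \<xi> * a / real b)) / of_nat (card ?B) * char M (- 2 * pi * \<xi> / real b)"
    unfolding ft_eq_char by (rule self_similar_char[OF self_similar]) auto
  also have "card ?B = N" unfolding B by (simp add: card_image[OF inj])
  also have "(\<Sum>a\<in>?B. iexp (- 2 * pi * \<xi> * a / real b)) = (\<Sum>d<N. expo (real q) (\<xi> / real b) ^ d)"
    unfolding B sum.reindex[OF inj] o_def
  proof (rule sum.cong)
    fix d
    have "iexp (- 2 * pi * \<xi> * (real q * real d) / real b) = expo 1 (\<xi> * (real q * real d) / real b)"
      unfolding expo_eq_iexp by (simp only: mult_1_right times_divide_eq_right mult.assoc)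
    also have "\<dots> = expo (real q) (\<xi> / real b) ^ d"
      unfolding expo_power by (rule expo_cong) simp
    finally show "iexp (- 2 * pi * \<xi> * (real q * real d) / real b) = expo (real q) (\<xi> / real b) ^ d" .
  qed simp
  finally show ?thesis by (simp add: mask_def ft_eq_char)
qed

lemma mask_int_shift: "mask (y + of_int k) = mask y"
  unfolding mask_def by (subst expo_int_shift) (auto simp: mult_ac)

text \<open>At this point \<open>expo q\<close> is an \<open>N\<close>-th root of unity other than
  1, so the geometric sum vanishes.\<close>

lemma mask_zero:
  assumes "\<not> int N dvd k"
  shows "mask (of_int k / real b) = 0"
proof -
  have "real q * (of_int k / real b) = of_int k / real N" using q by (simp add: b)
  moreover have "real_of_int k / real N \<notin> \<int>"
  proof
    assume "real_of_int k / real N \<in> \<int>"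
    then obtain j where "real_of_int k / real N = of_int j" by (auto elim: Ints_cases)
    then have "real_of_int k = of_int (j * int N)" using N by (simp add: field_simps)
    then have "k = j * int N" by (simp only: of_int_eq_iff)
    then show False using assms by simp
  qed
  ultimately have "expo (real q) (of_int k / real b) \<noteq> 1" by (simp add: expo_eq_1_iff)
  moreover have "expo (real q) (of_int k / real b) ^ N = 1"
    unfolding expo_power expo_eq_1_iff using q N by (simp add: b)
  ultimately show ?thesis using geometric_roots_of_unity by (simp add: mask_def)
qed

text \<open>A vanishing geometric sum forces \<open>expo q y ^ N = 1\<close>, that is,
  \<open>q * N * y\<close> is an integer.\<close>

lemma mask_zero_imp:
  assumes "mask y = 0"
  shows "real b * y \<in> \<int>"
proof -
  let ?z = "expo (real q) y"
  have "(\<Sum>d<N. ?z ^ d) = 0" using assms N by (simp add: mask_def)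
  moreover have "(1 - ?z) * (\<Sum>d<N. ?z ^ d) = 1 - ?z ^ N" by (simp add: one_diff_power_eq)
  ultimately have "?z ^ N = 1" by simp
  then show ?thesis by (simp add: expo_power expo_eq_1_iff b mult_ac)
qed

text \<open>Orthogonality of characters: \<open>digs\<close> is a complete residue system modulo
  \<open>N\<close>.\<close>

lemma sum_digs_expo:
  assumes "\<not> int N dvd k"
  shows "(\<Sum>c\<in>digs. expo (of_int k / real N) (of_int c)) = 0"
proof -
  let ?l = "of_int k / real N" and ?A = "(int N - 1) div 2"
  have "(\<Sum>c\<in>digs. expo ?l (of_int c)) = (\<Sum>i<N. expo ?l (of_int (int i - ?A)))"
    unfolding digs_eq by (subst sum.reindex) (auto simp: inj_on_def)
  also have "\<dots> = (\<Sum>i<N. expo ?l 1 ^ i * expo ?l (of_int (- ?A)))"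
  proof (rule sum.cong)
    fix i
    have "expo ?l 1 ^ i = expo ?l (real i)" unfolding expo_power by (rule expo_cong) simp
    then show "expo ?l (of_int (int i - ?A)) = expo ?l 1 ^ i * expo ?l (of_int (- ?A))"
      by (simp flip: expo_add_right)
  qed simp
  also have "\<dots> = (\<Sum>i<N. expo ?l 1 ^ i) * expo ?l (of_int (- ?A))" by (simp add: sum_distrib_right)
  also have "(\<Sum>i<N. expo ?l 1 ^ i) = 0"
  proof (rule geometric_roots_of_unity)
    show "expo ?l 1 ^ N = 1" unfolding expo_power expo_eq_1_iff using N by simp
    have "?l \<notin> \<int>"
    proof
      assume "?l \<in> \<int>"
      then obtain j where "?l = of_int j" by (auto elim: Ints_cases)
      then have "real_of_int k = of_int (j * int N)" using N by (simp add: field_simps)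
      then have "k = j * int N" by (simp only: of_int_eq_iff)
      then show False using assms by simp
    qed
    then show "expo ?l 1 \<noteq> 1" by (simp add: expo_eq_1_iff)
  qed
  finally show ?thesis by simp
qed

text \<open>Since \<open>t\<close> is invertible modulo \<open>N\<close>, the vectors of
  \<open>d\<close>-th powers indexed by \<open>c \<in> digs\<close> are orthogonal for different
  \<open>d\<close>. Expanding the square leaves only the \<open>N\<close> diagonal terms, each equal
  to \<open>N\<close>.\<close>

lemma sum_mask:
  assumes t: "coprime t N"
  shows "(\<Sum>c\<in>digs. (norm (mask ((\<xi> + real t * of_int c) / real b)))\<^sup>2) = 1"
proof -
  let ?z = "\<lambda>c::int. expo (real q) ((\<xi> + real t * of_int c) / real b)"
  let ?w = "expo (real q) (\<xi> / real b)"
  have cd: "card digs = N" unfolding digs_eq by (subst card_image) (auto simp: inj_on_def)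
  \<comment> \<open>The dependence on \<open>c\<close> separates as the character of index
    \<open>(d - d') * t\<close> modulo \<open>N\<close>.\<close>
  have zz: "?z c ^ d * cnj (?z c ^ d') = ?w ^ d * cnj (?w ^ d') * expo (of_int ((int d - int d') * int t) / real N) (of_int c)"
    for c d d'
  proof -
    have "?z c ^ d * cnj (?z c ^ d') = expo (real d * real q - real d' * real q) ((\<xi> + real t * of_int c) / real b)"
      unfolding expo_power cnj_expo expo_add[symmetric] by simp
    also have "\<dots> = expo (real d * real q - real d' * real q) (\<xi> / real b) *
        expo (real d * real q - real d' * real q) (real t * of_int c / real b)"
      by (simp add: add_divide_distrib flip: expo_add_right)
    also have "expo (real d * real q - real d' * real q) (\<xi> / real b) = ?w ^ d * cnj (?w ^ d')"
      unfolding expo_power cnj_expo expo_add[symmetric] by simp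
    also have "expo (real d * real q - real d' * real q) (real t * of_int c / real b)
        = expo (of_int ((int d - int d') * int t) / real N) (of_int c)"
    proof -
      have "(real d * real q - real d' * real q) * (real t * of_int c / real b)
          = of_int ((int d - int d') * int t) / real N * of_int c"
        using q N by (simp add: b field_simps)
      then show ?thesis by (rule expo_cong)
    qed
    finally show ?thesis .
  qed
  have orth: "(\<Sum>c\<in>digs. ?z c ^ d * cnj (?z c ^ d')) = (if d = d' then of_nat N else 0)"
    if "d < N" "d' < N" for d d'
  proof (cases "d = d'")
    case True
    have "?z c ^ d * cnj (?z c ^ d) = 1" for c
      by (metis complex_norm_square norm_expo norm_power of_real_1 power_one)
    then show ?thesis using True cd by simp
  next
    case False
    have "\<not> int N dvd (int d - int d') * int t"
    proof
      assume "int N dvd (int d - int d') * int t"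
      then have "int N dvd int d - int d'"
        using t by (metis coprime_commute coprime_dvd_mult_left_iff coprime_int_iff)
      then have "\<bar>int N\<bar> \<le> \<bar>int d - int d'\<bar>" using False by (intro dvd_imp_le_int) auto
      then show False using that by linarith
    qed
    from sum_digs_expo[OF this] have "(\<Sum>c\<in>digs. ?z c ^ d * cnj (?z c ^ d')) = 0"
      by (simp only: zz sum_distrib_left[symmetric] mult_zero_right)
    then show ?thesis using False by simp
  qed
  have sq: "complex_of_real ((norm (mask y))\<^sup>2)
      = (\<Sum>d<N. expo (real q) y ^ d) * cnj (\<Sum>d<N. expo (real q) y ^ d) / (of_nat N * of_nat N)" for y
    unfolding complex_norm_square mask_def by (simp del: cnj_sum)
  have "complex_of_real (\<Sum>c\<in>digs. (norm (mask ((\<xi> + real t * of_int c) / real b)))\<^sup>2)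
      = (\<Sum>c\<in>digs. (\<Sum>d<N. ?z c ^ d) * cnj (\<Sum>d<N. ?z c ^ d)) / (of_nat N * of_nat N)"
    unfolding of_real_sum sq by (rule sum_divide_distrib[symmetric])
  also have "(\<Sum>c\<in>digs. (\<Sum>d<N. ?z c ^ d) * cnj (\<Sum>d<N. ?z c ^ d))
      = (\<Sum>c\<in>digs. \<Sum>d<N. \<Sum>d'<N. ?z c ^ d * cnj (?z c ^ d'))"
    unfolding cnj_sum sum_product ..
  also have "\<dots> = (\<Sum>d<N. \<Sum>d'<N. \<Sum>c\<in>digs. ?z c ^ d * cnj (?z c ^ d'))"
    by (subst sum.swap, intro sum.cong refl, subst sum.swap, rule refl)
  also have "\<dots> = (\<Sum>d<N. \<Sum>d'<N. if d = d' then of_nat N else 0)"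
    by (intro sum.cong refl orth) auto
  also have "\<dots> = of_nat N * of_nat N" by simp
  finally have "complex_of_real (\<Sum>c\<in>digs. (norm (mask ((\<xi> + real t * of_int c) / real b)))\<^sup>2) = complex_of_real 1"
    using N by simp
  then show ?thesis by (simp only: of_real_eq_iff)
qed

fun mask_prod :: "nat \<Rightarrow> real \<Rightarrow> complex" where
  "mask_prod 0 \<xi> = 1"
| "mask_prod (Suc n) \<xi> = mask (\<xi> / real b) * mask_prod n (\<xi> / real b)"

lemma ft_mask_prod: "ft M \<xi> = mask_prod n \<xi> * ft M (\<xi> / real b ^ n)"
proof (induction n arbitrary: \<xi>)
  case (Suc n)
  show ?case
    unfolding mask_prod.simps by (subst ft_refine, subst Suc) (simp add: mult.assoc)
qed simp

text \<open>The exact Parseval identity at level \<open>n\<close>. Splitting off the lowest digit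
  reduces it to \<open>sum_mask\<close> and the same identity at a shifted
  \<open>\<xi>\<close>.\<close>

lemma sum_mask_prod:
  assumes t: "coprime t N"
  shows "(\<Sum>l\<in>dig n. (norm (mask_prod n (\<xi> + real t * of_int l)))\<^sup>2) = 1"
proof (induction n arbitrary: \<xi>)
  case (Suc n)
  have inj: "inj_on (\<lambda>(c, l). c + int b * l) (digs \<times> dig n)"
  proof (rule inj_onI, clarify)
    fix c l c' l' assume c: "c \<in> digs" "c' \<in> digs" and eq: "c + int b * l = c' + int b * l'"
    have "c - c' = int N * (int q * (l' - l))" using eq by (simp add: b algebra_simps)
    then have "int N dvd c - c'" by simp
    with c have "c = c'" using digs_diff by blast
    with eq show "c = c' \<and> l = l'" by simp
  qed
  have m: "mask_prod (Suc n) (\<xi> + real t * of_int (c + int b * l))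
     = mask ((\<xi> + real t * of_int c) / real b) * mask_prod n ((\<xi> + real t * of_int c) / real b + real t * of_int l)" for c l
  proof -
    \<comment> \<open>After division by \<open>b\<close> the higher digits become an integer shift,
      which the 1-periodic mask does not see.\<close>
    have eq: "(\<xi> + real t * of_int (c + int b * l)) / real b = (\<xi> + real t * of_int c) / real b + of_int (int t * l)"
      by (simp add: field_simps)
    show ?thesis unfolding mask_prod.simps eq mask_int_shift by simp
  qed
  have "(\<Sum>l\<in>dig (Suc n). (norm (mask_prod (Suc n) (\<xi> + real t * of_int l)))\<^sup>2)
      = (\<Sum>(c, l)\<in>digs \<times> dig n. (norm (mask_prod (Suc n) (\<xi> + real t * of_int (c + int b * l))))\<^sup>2)"
    unfolding dig.simps sum.reindex[OF inj] by (simp add: case_prod_beta)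
  also have "\<dots> = (\<Sum>c\<in>digs. \<Sum>l\<in>dig n. (norm (mask_prod (Suc n) (\<xi> + real t * of_int (c + int b * l))))\<^sup>2)"
    by (rule sum.cartesian_product[symmetric])
  also have "\<dots> = (\<Sum>c\<in>digs. (norm (mask ((\<xi> + real t * of_int c) / real b)))\<^sup>2 *
      (\<Sum>l\<in>dig n. (norm (mask_prod n ((\<xi> + real t * of_int c) / real b + real t * of_int l)))\<^sup>2))"
    unfolding m by (simp add: norm_mult power_mult_distrib sum_distrib_left)
  also have "\<dots> = 1" by (simp add: Suc sum_mask[OF t])
  finally show ?case .
qed simp

text \<open>The refinement equation strips one factor \<open>b\<close> at a time; at
  \<open>k\<close> itself the mask vanishes.\<close>

lemma ft_zero:
  assumes "\<not> int N dvd k"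
  shows "ft M (of_int (int b ^ j * k)) = 0"
proof (induction j)
  case 0
  then show ?case using ft_refine[of "of_int k"] mask_zero[OF assms] by simp
next
  case (Suc j)
  then show ?case using ft_refine[of "of_int (int b ^ Suc j * k)"] by simp
qed

lemma isCont_ft: "isCont (ft M) x"
proof -
  have "ft M = (\<lambda>\<xi>. char M (- 2 * pi * \<xi>))" by (rule ext) (rule ft_eq_char)
  then show ?thesis by (auto intro!: continuous_intros isCont_o2[OF _ isCont_char])
qed

lemma ft_div_tendsto: "(\<lambda>n. ft M (x / real b ^ n)) \<longlonglongrightarrow> 1"
proof -
  have "(\<lambda>n. x / real b ^ n) \<longlonglongrightarrow> 0"
    using b_ge by (intro LIMSEQ_divide_realpow_zero) auto
  from isCont_tendsto_compose[OF isCont_ft this] show ?thesis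
    by (simp add: ft_0[OF prob_M sets_M])
qed

text \<open>Since \<open>ft\<close> tends to 1 along \<open>y / b^n\<close>, some factor of a finite
  mask product vanishes, which makes \<open>b\<close> times its argument an integer and hence
  \<open>y\<close> too.\<close>

lemma ft_zero_imp:
  assumes "ft M y = 0"
  obtains k where "k \<noteq> 0" "y = of_int k"
proof -
  have "\<forall>\<^sub>F n in sequentially. ft M (y / real b ^ n) \<noteq> 0"
    using ft_div_tendsto by (rule tendsto_imp_eventually_ne) simp
  then obtain n where "ft M (y / real b ^ n) \<noteq> 0" by (auto simp: eventually_sequentially)
  then have "mask_prod n y = 0" using assms ft_mask_prod[of y n] by simp
  then have "y \<in> \<int>"
  proof (induction n arbitrary: y)
    case (Suc n)
    then consider "mask (y / real b) = 0" | "mask_prod n (y / real b) = 0" by auto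
    then show ?case
    proof cases
      case 1
      from mask_zero_imp[OF this] show ?thesis by simp
    next
      case 2
      from Suc.IH[OF this] have "real b * (y / real b) \<in> \<int>" by (intro Ints_mult) auto
      then show ?thesis by simp
    qed
  qed simp
  then obtain k where k: "y = of_int k" by (auto elim: Ints_cases)
  have "k \<noteq> 0" using assms k ft_0[OF prob_M sets_M] by auto
  then show thesis using k that by blast
qed

subsection \<open>A criterion for completeness\<close>

definition spectrum :: "real set" where
  "spectrum = real_of_int ` (\<Union>n. dig n)"

lemma complete_number_iff:
  "complete_number M spectrum t \<longleftrightarrow> orthonormal_basis_L2 M ((\<lambda>l. t * l) ` spectrum) expo"
proof -
  have expo: "expo = (\<lambda>l x. exp (- 2 * of_real pi * \<i> * of_real l * of_real x))"
    by (intro ext) (simp add: expo_def)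
  have "emeasure M (- {0..1}) = 0"
  proof -
    have "AE x in M. x \<notin> - {0..1}" using supp by simp
    then show ?thesis by (subst (asm) AE_iff_null_sets[symmetric]) auto
  qed
  then have "compactly_supported M"
    unfolding compactly_supported_def by (intro exI[of _ "{0..1}"]) simp
  then show ?thesis
    using prob_M sets_M by (simp add: complete_number_def spectral_pair_def expo spectrum_def)
qed

lemma ft_orth:
  assumes t: "coprime t N" and xy: "x \<in> dig n" "y \<in> dig n" "x \<noteq> y"
  shows "ft M (real t * of_int x - real t * of_int y) = 0"
proof -
  obtain j k where jk: "x - y = int b ^ j * k" "\<not> int N dvd k" using dig_diff[OF xy] by blast
  have "\<not> int N dvd int t * k"
    using t jk(2) by (metis coprime_commute coprime_dvd_mult_right_iff coprime_int_iff)
  from ft_zero[OF this, of j] have "ft M (of_int (int t * (x - y))) = 0"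
    by (simp add: jk(1) mult_ac)
  then show ?thesis by (simp add: right_diff_distrib)
qed

text \<open>The set \<open>T\<close> of the overview: all series of terms
  \<open>c\<^sub>k / b^k\<close> over \<open>k \<ge> 1\<close> with digits in \<open>digs\<close>.
  The closure of the finite sums makes it closed by definition.\<close>

definition attractor :: "real set" where
  "attractor = closure (\<Union>n. (\<lambda>l. of_int l / real b ^ n) ` dig n)"

lemma attractor_bounds:
  assumes "x \<in> attractor"
  shows "2 * (real b - 1) * x \<le> real N" "- (real N - 1) \<le> 2 * (real b - 1) * x"
proof -
  let ?K = "{- (real N - 1) / (2 * (real b - 1)) .. real N / (2 * (real b - 1))}"
  have b1: "0 < 2 * (real b - 1)" using b_ge by simp
  have "(\<Union>n. (\<lambda>l. of_int l / real b ^ n) ` dig n) \<subseteq> ?K"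
  proof clarify
    fix n l assume l: "l \<in> dig n"
    have bn: "0 < real b ^ n" by simp
    have "real_of_int (2 * (int b - 1) * l) \<le> real_of_int (int N * (int b ^ n - 1))"
      "real_of_int (- (int N - 1) * (int b ^ n - 1)) \<le> real_of_int (2 * (int b - 1) * l)"
      using dig_bounds[OF l] by (simp_all only: of_int_le_iff)
    then have le: "2 * (real b - 1) * l \<le> real N * (real b ^ n - 1)"
      "- (real N - 1) * (real b ^ n - 1) \<le> 2 * (real b - 1) * l" by simp_all
    have "real N * (real b ^ n - 1) \<le> real N * real b ^ n" by (intro mult_left_mono) auto
    with le(1) have "2 * (real b - 1) * l \<le> real N * real b ^ n" by linarith
    then have upper: "of_int l / real b ^ n \<le> real N / (2 * (real b - 1))"
      using b1 bn by (simp only: pos_divide_le_eq pos_le_divide_eq times_divide_eq_left) (simp add: mult_ac)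
    have "(real N - 1) * (real b ^ n - 1) \<le> (real N - 1) * real b ^ n"
      using N by (intro mult_left_mono) auto
    with le(2) have "- (real N - 1) * real b ^ n \<le> 2 * (real b - 1) * l" by linarith
    then have lower: "- (real N - 1) / (2 * (real b - 1)) \<le> of_int l / real b ^ n"
      using b1 bn by (simp only: pos_divide_le_eq pos_le_divide_eq times_divide_eq_left) (simp add: mult_ac)
    show "of_int l / real b ^ n \<in> ?K" using lower upper by auto
  qed
  then have "attractor \<subseteq> ?K" unfolding attractor_def by (rule closure_minimal) simp
  then have x: "- (real N - 1) / (2 * (real b - 1)) \<le> x" "x \<le> real N / (2 * (real b - 1))"
    using assms by auto
  show "2 * (real b - 1) * x \<le> real N"
    using x(2) b1 by (simp only: pos_le_divide_eq mult.commute[of x])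
  show "- (real N - 1) \<le> 2 * (real b - 1) * x"
    using x(1) b1 by (simp only: pos_divide_le_eq mult.commute[of x])
qed

lemma compact_attractor: "compact attractor"
proof -
  have "\<bar>x\<bar> \<le> real N" if "x \<in> attractor" for x
  proof -
    have "\<bar>2 * (real b - 1) * x\<bar> \<le> real N" using attractor_bounds[OF that] by linarith
    moreover have "1 * \<bar>x\<bar> \<le> (2 * (real b - 1)) * \<bar>x\<bar>" using b_ge by (intro mult_right_mono) auto
    ultimately show ?thesis using b_ge by (simp add: abs_mult)
  qed
  then have "bounded attractor" by (auto simp: bounded_iff)
  then show ?thesis by (simp add: compact_eq_bounded_closed attractor_def)
qed

text \<open>The inclusion of \<open>T\<close> in the union of the sets \<open>(T + c) / b\<close>.
  It holds for finite expansions by splitting off the leading digit, and extends to the closure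
  because the union is a finite union of compact sets.\<close>

lemma attractor_step:
  assumes "x \<in> attractor"
  obtains c where "c \<in> digs" "real b * x - of_int c \<in> attractor"
proof -
  let ?A = "\<Union>n. (\<lambda>l. of_int l / real b ^ n) ` dig n"
  let ?f = "\<lambda>c::int. \<lambda>y::real. (y + of_int c) / real b"
  have sub: "?A \<subseteq> attractor" unfolding attractor_def by (rule closure_subset)
  have "?A \<subseteq> (\<Union>c\<in>digs. ?f c ` attractor)"
  proof clarify
    fix n l assume l: "l \<in> dig n"
    show "of_int l / real b ^ n \<in> (\<Union>c\<in>digs. ?f c ` attractor)"
    proof (cases n)
      case 0
      have "0 \<in> ?A" by (rule UN_I[of 0]) auto
      then have "0 \<in> attractor" using sub by (rule rev_subsetD)
      then show ?thesis using l 0 zero_digs by (auto intro!: bexI[of _ 0] image_eqI[of _ _ 0])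
    next
      case (Suc m)
      obtain y c where y: "y \<in> dig m" "c \<in> digs" "l = y + int b ^ m * c"
        using l unfolding Suc by (rule dig_Suc_last)
      have "of_int y / real b ^ m \<in> attractor" using sub y(1) by blast
      moreover have "of_int l / real b ^ n = ?f c (of_int y / real b ^ m)"
        by (simp add: Suc y(3) field_simps)
      ultimately show ?thesis using y(2) by blast
    qed
  qed
  moreover have "closed (\<Union>c\<in>digs. ?f c ` attractor)"
  proof (intro closed_UN finite_digs ballI)
    fix c
    have "continuous_on attractor (?f c)" by (intro continuous_intros) auto
    then show "closed (?f c ` attractor)"
      by (intro compact_imp_closed compact_continuous_image compact_attractor)
  qed
  ultimately have "attractor \<subseteq> (\<Union>c\<in>digs. ?f c ` attractor)"
    unfolding attractor_def by (rule closure_minimal)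
  then obtain c y where "c \<in> digs" "y \<in> attractor" "x = ?f c y" using assms by blast
  then show thesis by (intro that[of c]) auto
qed

lemma attractor_nonempty: "attractor \<noteq> {}"
proof -
  have "(\<Union>n. (\<lambda>l. of_int l / real b ^ n) ` dig n) \<noteq> ({} :: real set)" using zero_dig by blast
  then show ?thesis unfolding attractor_def using closure_eq_empty by blast
qed

text \<open>By compactness \<open>ft\<close> is bounded away from 0 on \<open>t * T\<close>. The
  points in question differ from points of \<open>t * T\<close> by \<open>\<xi> / b^n\<close>, which
  tends to 0, and uniform continuity applies.\<close>

lemma ft_bounded_below_near_attractor:
  assumes nz: "\<And>x. x \<in> attractor \<Longrightarrow> ft M (t * x) \<noteq> 0"
  obtains \<delta> n0 where "\<delta> > 0" "\<forall>n\<ge>n0. \<forall>l\<in>dig n. \<delta> \<le> norm (ft M ((\<xi> + t * of_int l) / real b ^ n))"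
proof -
  have cont: "continuous_on S (ft M)" for S
    using isCont_ft by (simp add: continuous_at_imp_continuous_on)
  have "continuous_on attractor (\<lambda>x. norm (ft M (t * x)))"
    by (intro continuous_intros continuous_on_compose2[OF cont[of UNIV]]) auto
  from continuous_attains_inf[OF compact_attractor attractor_nonempty this]
  obtain x0 where x0: "x0 \<in> attractor" "\<And>x. x \<in> attractor \<Longrightarrow> norm (ft M (t * x0)) \<le> norm (ft M (t * x))" by auto
  \<comment> \<open>Half of the minimum; the other half absorbs the perturbation by
    \<open>\<xi> / b^n\<close>.\<close>
  define \<delta> where "\<delta> = norm (ft M (t * x0)) / 2"
  have \<delta>: "\<delta> > 0" using nz[OF x0(1)] by (simp add: \<delta>_def)
  have "bounded ((\<lambda>x. t * x) ` attractor)"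
    by (intro compact_imp_bounded compact_continuous_image compact_attractor continuous_intros)
  then obtain R where R: "\<And>x. x \<in> attractor \<Longrightarrow> norm (t * x) \<le> R" by (auto simp: bounded_iff)
  have "uniformly_continuous_on (cball 0 (R + 1)) (ft M)"
    by (intro compact_uniformly_continuous cont) auto
  then obtain e where e: "e > 0" "\<And>x y. x \<in> cball 0 (R + 1) \<Longrightarrow> y \<in> cball 0 (R + 1) \<Longrightarrow> dist y x < e \<Longrightarrow> dist (ft M y) (ft M x) < \<delta>"
    using \<delta> unfolding uniformly_continuous_on_def by blast
  have "(\<lambda>n. \<xi> / real b ^ n) \<longlonglongrightarrow> 0"
    using b_ge by (intro LIMSEQ_divide_realpow_zero) auto
  then have "\<forall>\<^sub>F n in sequentially. norm (\<xi> / real b ^ n) < min e 1"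
    using e(1) by (intro order_tendstoD(2)[OF tendsto_norm_zero]) auto
  then have "\<exists>n0. \<forall>n\<ge>n0. norm (\<xi> / real b ^ n) < min e 1" unfolding eventually_sequentially .
  then obtain n0 where n0: "\<forall>n\<ge>n0. norm (\<xi> / real b ^ n) < min e 1" ..
  have "\<delta> \<le> norm (ft M ((\<xi> + t * of_int l) / real b ^ n))" if n: "n \<ge> n0" and l: "l \<in> dig n" for n l
  proof -
    define x where "x = of_int l / real b ^ n"
    have "x \<in> (\<Union>n. (\<lambda>l. of_int l / real b ^ n) ` dig n)" unfolding x_def using l by blast
    then have x: "x \<in> attractor" unfolding attractor_def by (rule closure_subset[THEN subsetD])
    have eq: "(\<xi> + t * of_int l) / real b ^ n = t * x + \<xi> / real b ^ n"
      by (simp add: x_def add_divide_distrib)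
    have h: "norm (\<xi> / real b ^ n) < e" "norm (\<xi> / real b ^ n) < 1" using n0 n by simp_all
    have "norm (t * x + \<xi> / real b ^ n) \<le> R + 1"
      using norm_triangle_ineq[of "t * x" "\<xi> / real b ^ n"] R[OF x] h by linarith
    moreover have "norm (t * x) \<le> R + 1" using R[OF x] by linarith
    ultimately have "dist (ft M (t * x + \<xi> / real b ^ n)) (ft M (t * x)) < \<delta>"
      using h by (intro e(2)) (auto simp: dist_norm)
    moreover have "2 * \<delta> \<le> norm (ft M (t * x))" using x0(2)[OF x] by (simp add: \<delta>_def)
    ultimately show ?thesis
      unfolding eq dist_norm
      using norm_triangle_ineq3[of "ft M (t * x + \<xi> / real b ^ n)" "ft M (t * x)"] by linarith
  qed
  then have "\<forall>n\<ge>n0. \<forall>l\<in>dig n. \<delta> \<le> norm (ft M ((\<xi> + t * of_int l) / real b ^ n))" by simp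
  with \<delta> show thesis by (rule that)
qed

lemma mask_prod_tendsto: "(\<lambda>n. mask_prod n x) \<longlonglongrightarrow> ft M x"
proof -
  have "(\<lambda>n. ft M x / ft M (x / real b ^ n)) \<longlonglongrightarrow> ft M x / 1"
    by (intro tendsto_divide tendsto_const ft_div_tendsto) simp
  moreover have "\<forall>\<^sub>F n in sequentially. ft M (x / real b ^ n) \<noteq> 0"
    using ft_div_tendsto by (rule tendsto_imp_eventually_ne) simp
  then have "\<forall>\<^sub>F n in sequentially. ft M x / ft M (x / real b ^ n) = mask_prod n x"
  proof eventually_elim
    case (elim n)
    then show ?case using ft_mask_prod[of x n] by simp
  qed
  ultimately show ?thesis by (simp add: tendsto_cong)
qed

text \<open>The squared mask products sum to exactly 1 at each level and tend termwise to the
  squared \<open>ft\<close>. The lower bound \<open>\<delta>\<close> dominates them by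
  \<open>a l / \<delta>^2\<close>, so no mass is lost in the limit.\<close>

lemma complete_if_ft_nonzero_on_attractor:
  assumes t: "coprime t N" "t > 0" and nz: "\<And>x. x \<in> attractor \<Longrightarrow> ft M (real t * x) \<noteq> 0"
  shows "complete_number M spectrum (real t)"
  unfolding complete_number_iff
proof (rule orthonormal_basis_expo[OF prob_M sets_M supp])
  fix l l' assume "l \<in> (\<lambda>l. real t * l) ` spectrum" "l' \<in> (\<lambda>l. real t * l) ` spectrum" "l \<noteq> l'"
  then obtain x y m n where x: "l = real t * of_int x" "x \<in> dig m" and y: "l' = real t * of_int y" "y \<in> dig n"
    by (auto simp: spectrum_def)
  have "x \<in> dig (max m n)" "y \<in> dig (max m n)" "x \<noteq> y"
    using x y dig_mono[of m "max m n"] dig_mono[of n "max m n"] \<open>l \<noteq> l'\<close> by auto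
  from ft_orth[OF t(1) this] show "ft M (l - l') = 0" using x y by simp
next
  fix \<xi>' \<epsilon> :: real assume "\<epsilon> > 0"
  \<comment> \<open>Parseval involves \<open>\<xi>' - t l\<close>, the mask identities
    \<open>\<xi> + t l\<close>; the two norms agree because \<open>ft\<close> at \<open>- x\<close>
    is the conjugate of \<open>ft\<close> at \<open>x\<close>.\<close>
  define \<xi> where "\<xi> = - \<xi>'"
  define a where "a l = (norm (ft M (\<xi> + real t * of_int l)))\<^sup>2" for l
  define A where "A n = (\<Sum>l\<in>dig n. a l)" for n
  have inj: "inj_on (\<lambda>l. real t * of_int l) (dig n)" for n using t(2) by (auto simp: inj_on_def)
  have A_eq: "A n = (\<Sum>l\<in>(\<lambda>l. real t * of_int l) ` dig n. (norm (ft M (\<xi>' - l)))\<^sup>2)" for n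
  proof -
    have "norm (ft M (\<xi>' - real t * of_int l)) = norm (ft M (\<xi> + real t * of_int l))" for l
      using norm_ft_uminus[of M "\<xi>' - real t * of_int l"] by (simp add: \<xi>_def)
    then show ?thesis by (simp add: sum.reindex[OF inj] A_def a_def)
  qed
  have A_le1: "A n \<le> 1" for n
    unfolding A_eq
    by (rule Bessel_expo[OF prob_M sets_M]) (auto intro!: ft_orth[OF t(1)])
  have A_mono: "mono A"
  proof (rule monoI)
    fix m n :: nat assume "m \<le> n"
    then show "A m \<le> A n" unfolding A_def by (intro sum_mono2 dig_mono) (auto simp: a_def)
  qed
  have A_nonneg: "0 \<le> A n" for n unfolding A_def a_def by (intro sum_nonneg) simp
  have "convergent A"
  proof (rule Bseq_mono_convergent)
    show "Bseq A" by (rule BseqI'[of _ 1]) (use A_le1 A_nonneg in simp)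
  qed (use A_mono in \<open>simp add: mono_def\<close>)
  then obtain L where L: "A \<longlonglongrightarrow> L" by (auto simp: convergent_def)
  obtain \<delta> n0 where \<delta>: "\<delta> > 0"
    "\<forall>n\<ge>n0. \<forall>l\<in>dig n. \<delta> \<le> norm (ft M ((\<xi> + real t * of_int l) / real b ^ n))"
    by (rule ft_bounded_below_near_attractor[where t="real t" and \<xi>=\<xi>, OF nz])
  \<comment> \<open>Elements of \<open>dig k\<close> are kept exactly; only the remaining ones are
    estimated by the domination.\<close>
  have tail: "1 \<le> (\<Sum>l\<in>dig k. (norm (mask_prod n (\<xi> + real t * of_int l)))\<^sup>2) + (A n - A k) / \<delta>\<^sup>2"
    if "n \<ge> n0" "k \<le> n" for n k
  proof -
    let ?p = "\<lambda>l. (norm (mask_prod n (\<xi> + real t * of_int l)))\<^sup>2"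
    have p_le: "?p l \<le> a l / \<delta>\<^sup>2" if "l \<in> dig n" for l
    proof -
      have "a l = ?p l * (norm (ft M ((\<xi> + real t * of_int l) / real b ^ n)))\<^sup>2"
        unfolding a_def by (subst ft_mask_prod[of _ n]) (simp add: norm_mult power_mult_distrib)
      moreover have "\<delta>\<^sup>2 \<le> (norm (ft M ((\<xi> + real t * of_int l) / real b ^ n)))\<^sup>2"
        using \<delta> \<open>n \<ge> n0\<close> that by (intro power_mono) auto
      ultimately have "?p l * \<delta>\<^sup>2 \<le> a l" by (simp add: mult_left_mono)
      then show ?thesis using \<delta>(1) by (simp add: pos_le_divide_eq)
    qed
    have sub: "dig k \<subseteq> dig n" using that by (intro dig_mono)
    have "1 = (\<Sum>l\<in>dig n. ?p l)" by (rule sum_mask_prod[OF t(1), symmetric])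
    also have "\<dots> = (\<Sum>l\<in>dig n - dig k. ?p l) + (\<Sum>l\<in>dig k. ?p l)"
      by (rule sum.subset_diff[OF sub]) simp
    also have "(\<Sum>l\<in>dig n - dig k. ?p l) \<le> (\<Sum>l\<in>dig n - dig k. a l / \<delta>\<^sup>2)"
      by (intro sum_mono p_le) auto
    also have "(\<Sum>l\<in>dig n - dig k. a l / \<delta>\<^sup>2) = (A n - A k) / \<delta>\<^sup>2"
      by (simp add: A_def sum_divide_distrib[symmetric] sum_diff[OF finite_dig sub])
    finally show ?thesis by simp
  qed
  \<comment> \<open>First \<open>n\<close> tends to infinity with \<open>k\<close> fixed; afterwards
    \<open>k\<close> does.\<close>
  have "1 \<le> A k + (L - A k) / \<delta>\<^sup>2" for k
  proof (rule LIMSEQ_le_const)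
    show "(\<lambda>n. (\<Sum>l\<in>dig k. (norm (mask_prod n (\<xi> + real t * of_int l)))\<^sup>2) + (A n - A k) / \<delta>\<^sup>2)
        \<longlonglongrightarrow> A k + (L - A k) / \<delta>\<^sup>2"
      unfolding A_def[of k] a_def using \<delta>(1)
      by (intro tendsto_intros mask_prod_tendsto L) auto
    show "\<exists>m. \<forall>n\<ge>m. 1 \<le> (\<Sum>l\<in>dig k. (norm (mask_prod n (\<xi> + real t * of_int l)))\<^sup>2) + (A n - A k) / \<delta>\<^sup>2"
      by (rule exI[of _ "max n0 k"]) (auto intro!: tail)
  qed
  moreover have "(\<lambda>k. A k + (L - A k) / \<delta>\<^sup>2) \<longlonglongrightarrow> L + (L - L) / \<delta>\<^sup>2"
    using \<delta>(1) by (intro tendsto_intros L) auto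
  ultimately have "1 \<le> L + (L - L) / \<delta>\<^sup>2" by (intro LIMSEQ_le_const) auto
  then have "1 - \<epsilon> < L" using \<open>\<epsilon> > 0\<close> by simp
  from order_tendstoD(1)[OF L this] obtain n where "1 - \<epsilon> < A n" by (auto simp: eventually_sequentially)
  then show "\<exists>F. finite F \<and> F \<subseteq> (\<lambda>l. real t * l) ` spectrum \<and> 1 - \<epsilon> < (\<Sum>l\<in>F. (norm (ft M (\<xi>' - l)))\<^sup>2)"
    unfolding A_eq by (intro exI[of _ "(\<lambda>l. real t * of_int l) ` dig n"]) (auto simp: spectrum_def)
qed

section \<open>Integer points of the scaled attractor\<close>

definition int_points :: "nat \<Rightarrow> int set" where
  "int_points t = {k. \<exists>x\<in>attractor. of_int k = real t * x}"

text \<open>All zeros of \<open>ft\<close> are nonzero integers, so only nonzero integer points of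
  \<open>t * T\<close> could obstruct the criterion.\<close>

lemma complete_if_no_int_points:
  assumes "coprime t N" "t > 0" "int_points t \<subseteq> {0}"
  shows "complete_number M spectrum (real t)"
proof (rule complete_if_ft_nonzero_on_attractor[OF assms(1,2)])
  fix x assume x: "x \<in> attractor"
  show "ft M (real t * x) \<noteq> 0"
  proof
    assume "ft M (real t * x) = 0"
    then obtain k where "k \<noteq> 0" "real t * x = of_int k" by (rule ft_zero_imp)
    then have "k \<in> int_points t" using x by (auto simp: int_points_def intro!: bexI[of _ x])
    then show False using assms(3) \<open>k \<noteq> 0\<close> by auto
  qed
qed

lemma int_points_bounds:
  assumes "k \<in> int_points t"
  shows "2 * (int b - 1) * k \<le> int N * int t" "- ((int N - 1) * int t) \<le> 2 * (int b - 1) * k"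
proof -
  obtain x where x: "x \<in> attractor" "of_int k = real t * x" using assms by (auto simp: int_points_def)
  have "real t * (2 * (real b - 1) * x) \<le> real t * real N"
    "real t * (- (real N - 1)) \<le> real t * (2 * (real b - 1) * x)"
    using attractor_bounds[OF x(1)] by (intro mult_left_mono; simp)+
  then have "2 * (real b - 1) * of_int k \<le> real N * real t"
    "- ((real N - 1) * real t) \<le> 2 * (real b - 1) * of_int k"
    unfolding x(2) by (simp_all add: algebra_simps)
  then have "real_of_int (2 * (int b - 1) * k) \<le> real_of_int (int N * int t)"
    "real_of_int (- ((int N - 1) * int t)) \<le> real_of_int (2 * (int b - 1) * k)" by simp_all
  then show "2 * (int b - 1) * k \<le> int N * int t" "- ((int N - 1) * int t) \<le> 2 * (int b - 1) * k"
    by (simp_all only: of_int_le_iff)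
qed

lemma finite_int_points: "finite (int_points t)"
proof (rule finite_subset)
  show "int_points t \<subseteq> {- (int N * int t) .. int N * int t}"
  proof
    fix k assume k: "k \<in> int_points t"
    have "\<bar>2 * (int b - 1) * k\<bar> \<le> int N * int t"
      using int_points_bounds[OF k] by (simp add: left_diff_distrib abs_le_iff)
    moreover have "1 * \<bar>k\<bar> \<le> (2 * (int b - 1)) * \<bar>k\<bar>" using b_ge by (intro mult_right_mono) auto
    ultimately have "\<bar>k\<bar> \<le> int N * int t" using b_ge by (simp add: abs_mult)
    then show "k \<in> {- (int N * int t) .. int N * int t}" by auto
  qed
qed simp

text \<open>If \<open>k = t x\<close> and \<open>b x - c\<close> is in \<open>T\<close> for a digit
  \<open>c\<close>, then \<open>b k - t c\<close> is again an integer point, congruent to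
  \<open>b k\<close> modulo \<open>t\<close>.\<close>

lemma int_points_step:
  assumes "k \<in> int_points t"
  obtains k' where "k' \<in> int_points t" "int t dvd k' - int b * k"
proof -
  obtain x where x: "x \<in> attractor" "of_int k = real t * x" using assms by (auto simp: int_points_def)
  obtain c where c: "c \<in> digs" "real b * x - of_int c \<in> attractor" using x(1) by (rule attractor_step)
  have "real_of_int (int b * k - int t * c) = real t * (real b * x - of_int c)"
    using x(2) by (simp add: algebra_simps)
  then have "int b * k - int t * c \<in> int_points t" using c(2) by (auto simp: int_points_def)
  moreover have "int t dvd (int b * k - int t * c) - int b * k" by simp
  ultimately show thesis by (rule that)
qed

lemma int_points_iterate:
  assumes "k \<in> int_points t"
  shows "\<exists>k'\<in>int_points t. int t dvd k' - int b ^ n * k"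
proof (induction n)
  case 0
  then show ?case using assms by (intro bexI[of _ k]) auto
next
  case (Suc n)
  then obtain k' where k': "k' \<in> int_points t" "int t dvd k' - int b ^ n * k" by blast
  obtain k'' where k'': "k'' \<in> int_points t" "int t dvd k'' - int b * k'" using k'(1) by (rule int_points_step)
  have "int t dvd (k'' - int b * k') + int b * (k' - int b ^ n * k)"
    using k'(2) k''(2) by (intro dvd_add dvd_mult)
  also have "(k'' - int b * k') + int b * (k' - int b ^ n * k) = k'' - int b ^ Suc n * k"
    by (simp add: algebra_simps)
  finally have "int t dvd k'' - int b ^ Suc n * k" .
  then show ?case using k''(1) by blast
qed

subsection \<open>Complete and incomplete families\<close>

lemma complete_1: "complete_number M spectrum (real 1)"
proof (rule complete_if_no_int_points)
  show "int_points 1 \<subseteq> {0}"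
  proof
    fix k assume k: "k \<in> int_points 1"
    have "\<bar>2 * (int b - 1) * k\<bar> \<le> int N" using int_points_bounds[OF k] by (simp add: abs_le_iff)
    \<comment> \<open>By \<open>2 N \<le> b\<close>, the attractor lies strictly between -1 and
      1.\<close>
    also have "\<dots> < 2 * (int b - 1)" using b_ge(2) N by auto
    finally have "(2 * (int b - 1)) * \<bar>k\<bar> < 2 * (int b - 1)" using b_ge by (simp add: abs_mult)
    then have "\<bar>k\<bar> < 1" using b_ge by (simp add: mult_less_cancel_left1)
    then show "k \<in> {0}" by simp
  qed
qed auto

text \<open>Modulo \<open>t = N b\<^sup>n - 1\<close> the number \<open>b\<^bsup>n+1\<^esup>\<close> is congruent to \<open>q\<close>. The integer points of
  \<open>t\<close> times the attractor are too small for a wrap-around, so this finite set is closed under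
  multiplication by \<open>q\<close>.\<close>

lemma complete_family:
  assumes n: "n > 0"
  shows "coprime (N * b ^ n - 1) b" "complete_number M spectrum (real (N * b ^ n - 1))"
proof -
  define t where "t = N * b ^ n - 1"
  have t1: "t + 1 = N * b ^ n" "t > 0"
  proof -
    have "1 \<le> b ^ n" by (simp add: Suc_le_eq)
    from mult_le_mono[OF N this] have "2 * 1 \<le> N * b ^ n" .
    then show "t + 1 = N * b ^ n" "t > 0" unfolding t_def by auto
  qed
  show cop: "coprime (N * b ^ n - 1) b"
  proof -
    have "b dvd t + 1" unfolding t1(1) using n by simp
    moreover have "coprime t (t + 1)" by simp
    ultimately show ?thesis unfolding t_def[symmetric] using coprime_divisors dvd_refl by blast
  qed
  then have copN: "coprime t N" by (simp add: t_def b)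
  have "int_points t \<subseteq> {0}"
  proof (rule ccontr)
    assume "\<not> int_points t \<subseteq> {0}"
    then obtain k0 where k0: "k0 \<in> int_points t" "k0 \<noteq> 0" by auto
    \<comment> \<open>The contradiction will come from an integer point of maximal modulus:
      multiplied by \<open>q\<close> it must still be one.\<close>
    define m where "m = Max (abs ` int_points t)"
    have m: "\<bar>k\<bar> \<le> m" if "k \<in> int_points t" for k
      unfolding m_def using that finite_int_points by (intro Max_ge) auto
    have "m \<in> abs ` int_points t" unfolding m_def using k0 finite_int_points by (intro Max_in) auto
    then obtain k where k: "k \<in> int_points t" "\<bar>k\<bar> = m" by auto
    obtain k' where k': "k' \<in> int_points t" "int t dvd k' - int b ^ Suc n * k"
      using int_points_iterate[OF k(1), of "Suc n"] by blast
    have "int b ^ Suc n = int q * (int N * int b ^ n)" by (simp add: b)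
    also have "int N * int b ^ n = int t + 1" using t1(1) by (metis of_nat_1 of_nat_add of_nat_mult of_nat_power)
    finally have "(k' - int b ^ Suc n * k) + int t * (int q * k) = k' - int q * k" by (simp add: algebra_simps)
    moreover have "int t dvd (k' - int b ^ Suc n * k) + int t * (int q * k)"
      using k'(2) by (intro dvd_add) auto
    ultimately have dvd: "int t dvd k' - int q * k" by (simp only:)
    have kq: "int q * (2 * (int b - 1) * k) \<le> int q * (int N * int t)"
      "int q * (- ((int N - 1) * int t)) \<le> int q * (2 * (int b - 1) * k)"
      using int_points_bounds[OF k(1)] by (intro mult_left_mono; simp)+
    note k'b = int_points_bounds[OF k'(1)]
    \<comment> \<open>With \<open>b = q * N\<close>, the no-wrap-around inequality that follows is
      equivalent to \<open>(q - 1) * N > 1\<close>.\<close>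
    have "1 * 2 \<le> (int q - 1) * int N" using N q by (intro mult_mono) auto
    then have qN: "int q * int N + int N - 1 < 2 * (int b - 1)" by (simp add: b algebra_simps)
    have qN': "int q * int N + int N - int q \<le> int q * int N + int N - 1" using q by simp
    have "2 * (int b - 1) * (k' - int q * k) \<le> (int q * int N + int N - int q) * int t"
      using k'b kq by (simp add: algebra_simps)
    also have "\<dots> \<le> (int q * int N + int N - 1) * int t" using qN' by (intro mult_right_mono) auto
    finally have up: "2 * (int b - 1) * (k' - int q * k) \<le> (int q * int N + int N - 1) * int t" .
    have lo: "- ((int q * int N + int N - 1) * int t) \<le> 2 * (int b - 1) * (k' - int q * k)"
      using k'b kq by (simp add: algebra_simps)
    have "\<bar>2 * (int b - 1) * (k' - int q * k)\<bar> \<le> (int q * int N + int N - 1) * int t"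
      using up lo by (simp add: abs_le_iff)
    also have "\<dots> < 2 * (int b - 1) * int t" using qN t1(2) by (intro mult_strict_right_mono) auto
    finally have "\<bar>k' - int q * k\<bar> < int t" using b_ge by (simp add: abs_mult)
    then have "k' = int q * k" using dvd dvd_imp_le_int[of "k' - int q * k" "int t"] by auto
    then have "int q * m = \<bar>k'\<bar>" using k(2) by (simp add: abs_mult)
    then have "int q * m \<le> m" using m[OF k'(1)] by simp
    moreover have "m > 0" using m[OF k0(1)] k0(2) by linarith
    ultimately show False using q by (simp add: mult_le_cancel_right1)
  qed
  then show "complete_number M spectrum (real (N * b ^ n - 1))"
    using complete_if_no_int_points[OF copN t1(2)] by (simp add: t_def)
qed

text \<open>Repeating the block \<open>s\<close> periodically gives elements \<open>S\<close> of the
  spectrum with \<open>t S\<close> congruent to \<open>- x\<close> modulo arbitrarily high powers of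
  \<open>b\<close>. So \<open>- x\<close> differs from each \<open>t l\<close> like two distinct
  elements of \<open>t * spectrum\<close> do, and \<open>ft\<close> vanishes there.\<close>

lemma incomplete_if_cycle:
  assumes t: "coprime t N" and s: "s \<in> dig m" "s > 0" and eq: "x * (int b ^ m - 1) = int t * s"
  shows "\<not> complete_number M spectrum (real t)"
  unfolding complete_number_iff
proof (rule not_orthonormal_basis_expo[OF prob_M sets_M, where \<eta>="- of_int x"])
  fix y assume "y \<in> (\<lambda>l. real t * l) ` spectrum"
  then obtain l n where l: "y = real t * of_int l" "l \<in> dig n" by (auto simp: spectrum_def)
  have "m > 0" using s by (cases m) auto
  \<comment> \<open>\<open>S\<close> is the block \<open>s\<close> repeated \<open>k\<close> times;
    its growth \<open>k \<le> S\<close> serves to make it different from a given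
    \<open>l\<close>.\<close>
  have "\<exists>S. S \<in> dig (k * m) \<and> int k \<le> S \<and> x + int t * S = int b ^ (k * m) * x" for k
  proof (induction k)
    case 0
    then show ?case by auto
  next
    case (Suc k)
    then obtain S where S: "S \<in> dig (k * m)" "int k \<le> S" "x + int t * S = int b ^ (k * m) * x" by blast
    have "s + int b ^ m * S \<in> dig (Suc k * m)" using dig_append[OF s(1) S(1)] by simp
    moreover have "1 * S \<le> int b ^ m * S" using S(2) b_ge by (intro mult_right_mono) auto
    then have "int (Suc k) \<le> s + int b ^ m * S" using S(2) s(2) by simp
    moreover have "x + int t * (s + int b ^ m * S) = int b ^ (Suc k * m) * x"
    proof -
      have "x + int t * (s + int b ^ m * S) = x + int t * s + int b ^ m * (int t * S)"
        by (simp add: algebra_simps)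
      also have "\<dots> = x + x * (int b ^ m - 1) + int b ^ m * (int t * S)" by (simp only: eq)
      also have "\<dots> = int b ^ m * (x + int t * S)" by (simp add: algebra_simps)
      finally show ?thesis by (simp add: S(3) power_add)
    qed
    ultimately show ?case by blast
  qed
  \<comment> \<open>The number of repetitions exceeds \<open>|l|\<close>, so that
    \<open>S \<noteq> l\<close>, and \<open>n\<close>, so that \<open>l\<close> fits into
    \<open>k * m\<close> digits.\<close>
  from this[of "n + nat \<bar>l\<bar> + 1"] obtain k S where k: "k = n + nat \<bar>l\<bar> + 1"
    and S: "S \<in> dig (k * m)" "int k \<le> S" "x + int t * S = int b ^ (k * m) * x" by blast
  have "n \<le> k" using k by simp
  also have "k \<le> k * m" using \<open>m > 0\<close> by simp
  finally have "l \<in> dig (k * m)" using l(2) dig_mono by blast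
  moreover have "l \<noteq> S" using S(2) k by auto
  ultimately obtain j i where ji: "j < k * m" "l - S = int b ^ j * i" "\<not> int N dvd i"
    using S(1) by (meson dig_diff)
  \<comment> \<open>As \<open>j < k * m\<close>, at least one factor \<open>b\<close> remains after
    extracting \<open>b^j\<close>; it makes the term with \<open>x\<close> divisible by
    \<open>N\<close>.\<close>
  obtain r where r: "k * m = j + Suc r" using less_imp_Suc_add[OF ji(1)] by auto
  have "int b ^ (k * m) = int b ^ j * (int b * int b ^ r)"
    by (simp add: r power_add)
  then have "x + int t * l = int b ^ j * (int b * int b ^ r * x + int t * i)"
  proof -
    have "x + int t * l = (x + int t * S) + int t * (l - S)" by (simp add: algebra_simps)
    also have "\<dots> = int b ^ (k * m) * x + int t * (int b ^ j * i)" by (simp only: S(3) ji(2))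
    finally show ?thesis using \<open>int b ^ (k * m) = _\<close> by (simp add: algebra_simps)
  qed
  moreover have "\<not> int N dvd int b * int b ^ r * x + int t * i"
  proof -
    have "\<not> int N dvd int t * i"
      using t ji(3) by (metis coprime_commute coprime_dvd_mult_right_iff coprime_int_iff)
    moreover have "int N dvd int b * int b ^ r * x" by (simp add: b mult.assoc)
    ultimately show ?thesis by (simp add: dvd_add_right_iff)
  qed
  ultimately have "ft M (of_int (x + int t * l)) = 0" using ft_zero by metis
  then show "ft M (y - - of_int x) = 0" by (simp add: l(1) add.commute)
qed

lemma repunit_dig: "(\<Sum>k<m. int b ^ k) \<in> dig m"
proof (induction m)
  case (Suc m)
  have "1 + int b * (\<Sum>k<m. int b ^ k) \<in> dig (Suc m)" by (rule dig_SucI[OF one_digs Suc])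
  also have "1 + int b * (\<Sum>k<m. int b ^ k) = (\<Sum>k<Suc m. int b ^ k)"
    by (simp add: sum.lessThan_Suc_shift sum_distrib_left del: sum.lessThan_Suc)
  finally show ?case .
qed simp

text \<open>The cycle consists of \<open>b - 1\<close> digits \<open>1\<close> followed by zeros: these digits have sum
  \<open>b - 1\<close>, so that \<open>b - 1\<close> divides the number they represent.\<close>

lemma incomplete_repunit:
  assumes m: "b - 1 \<le> m"
  shows "\<not> complete_number M spectrum (real (\<Sum>k<m. b ^ k))"
proof -
  let ?s = "\<Sum>k<b - 1. int b ^ k"
  have "[?s = (\<Sum>k<b - 1. 1)] (mod (int b - 1))"
  proof (rule cong_sum)
    fix k
    have "[int b = 1] (mod (int b - 1))" by (simp add: cong_iff_dvd_diff)
    from cong_pow[OF this, of k] show "[int b ^ k = 1] (mod (int b - 1))" by simp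
  qed
  also have "(\<Sum>k<b - 1. 1) = int b - 1" using b_ge by (simp add: of_nat_diff)
  finally have "int b - 1 dvd ?s \<longleftrightarrow> int b - 1 dvd int b - 1" by (rule cong_dvd_iff)
  then have "int b - 1 dvd ?s" by simp
  then obtain x where x: "?s = (int b - 1) * x" ..
  have "?s \<in> dig m" using repunit_dig[of "b - 1"] dig_mono[OF m] by blast
  moreover have "?s > 0" using b_ge by (intro sum_pos) (auto simp: lessThan_empty_iff)
  \<comment> \<open>Both sides equal \<open>(b - 1) * x\<close> times the repunit, since
    \<open>b^m - 1\<close> is \<open>b - 1\<close> times the repunit.\<close>
  moreover have "x * (int b ^ m - 1) = int (\<Sum>k<m. b ^ k) * ?s"
    unfolding power_diff_1_eq x by (simp add: mult_ac)
  moreover have "coprime (\<Sum>k<m. b ^ k) N"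
  proof (cases m)
    case 0
    then show ?thesis using m b_ge by simp
  next
    case (Suc n)
    have "(\<Sum>k<m. b ^ k) = N * (q * (\<Sum>k<n. b ^ k)) + 1"
      unfolding Suc by (subst sum.lessThan_Suc_shift) (simp add: sum_distrib_left b mult_ac)
    moreover have "coprime (N * (q * (\<Sum>k<n. b ^ k)) + 1) (N * (q * (\<Sum>k<n. b ^ k)))"
      by (rule coprime_add_one_left)
    ultimately show ?thesis by (simp only: coprime_mult_right_iff)
  qed
  ultimately show ?thesis by (intro incomplete_if_cycle)
qed

text \<open>The exponent is congruent to 1 modulo all the relevant orders, so the repunit is congruent to 1
  modulo every small \<open>d\<close>.\<close>

lemma repunit_without_small_divisors:
  fixes K :: nat
  defines "m \<equiv> Suc (b * fact (b * K))"
  assumes d: "d dvd (\<Sum>k<m. b ^ k)" "d \<le> K"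
  shows "d = 1"
proof -
  let ?u = "\<Sum>k<m. int b ^ k"
  have "int b * (\<Sum>k<b * fact (b * K). int b ^ k) + 1 = ?u"
    unfolding m_def by (subst sum.lessThan_Suc_shift) (simp add: sum_distrib_left)
  then have "coprime (int b) ?u" by (metis coprime_add_one_right coprime_mult_left_iff)
  moreover have du: "int d dvd ?u"
    using d(1) by (metis (no_types, lifting) int_dvd_int_iff of_nat_power of_nat_sum sum.cong)
  ultimately have cop: "coprime b d"
    by (metis coprime_divisors coprime_int_iff dvd_refl)
  then have d0: "d > 0" using b_ge by (cases d) auto
  \<comment> \<open>The extra factor \<open>b - 1\<close> is cancelled at the end, where
    \<open>b^m - b = (b - 1) * (u - 1)\<close> for the repunit \<open>u\<close>.\<close>
  define n where "n = (b - 1) * d"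
  have n: "n > 0" "n \<le> b * K" using d0 b_ge d(2) unfolding n_def by (auto intro: mult_le_mono)
  have "coprime b (b - 1)" using b_ge by (metis coprime_diff_one_right_nat b_pos(1))
  then have "coprime b n" using cop by (simp add: n_def)
  then have "[b ^ totient n = 1] (mod n)" by (rule euler_theorem)
  \<comment> \<open>\<open>totient n \<le> n \<le> b * K\<close>, so it divides the
    factorial.\<close>
  moreover have "totient n dvd b * fact (b * K)"
    using n totient_le[of n] by (intro dvd_mult dvd_fact) (auto simp: Suc_le_eq)
  ultimately have "[b ^ (b * fact (b * K)) = 1] (mod n)"
    by (metis cong_pow dvdE power_mult power_one)
  then have "[int b ^ (b * fact (b * K)) = 1] (mod int n)"
    by (metis cong_int_iff of_nat_1 of_nat_power)
  then have "[int b * int b ^ (b * fact (b * K)) = int b * 1] (mod int n)" by (rule cong_scalar_left)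
  then have "int n dvd int b ^ m - int b" by (simp add: m_def cong_iff_dvd_diff)
  also have "int b ^ m - int b = (int b - 1) * (?u - 1)"
    using power_diff_1_eq[of "int b" m] by (simp add: algebra_simps)
  finally have "(int b - 1) * int d dvd (int b - 1) * (?u - 1)"
    using b_ge by (simp add: n_def of_nat_diff)
  then have "int d dvd ?u - 1" using b_ge by simp
  with du have "int d dvd ?u - (?u - 1)" by (rule dvd_diff)
  then show "d = 1" by simp
qed

section \<open>Infinitely many primitive numbers of both kinds\<close>

lemma infinite_primitive_complete: "infinite {t. primitive_complete_number N b M spectrum t}"
  unfolding infinite_nat_iff_unbounded
proof
  fix K :: nat
  define t where "t = N * b ^ Suc K - 1"
  have "Suc K < b ^ Suc K" using b_ge by (intro power_gt_expt) auto
  moreover have "1 * b ^ Suc K \<le> N * b ^ Suc K" using N by (intro mult_right_mono) auto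
  ultimately have t: "t > K" unfolding t_def by linarith
  have "coprime t b" "complete_number M spectrum (real t)"
    unfolding t_def by (rule complete_family; simp)+
  moreover from this(1) have "coprime t N" by (simp add: b)
  ultimately have "primitive_complete_number N b M spectrum t"
    using t by (simp add: primitive_complete_number_def)
  then show "\<exists>n>K. n \<in> {t. primitive_complete_number N b M spectrum t}" using t by auto
qed

text \<open>The least incomplete divisor \<open>d\<close> of the repunit is primitive, since its
  proper divisors are smaller divisors of the repunit. It is not 1 by \<open>complete_1\<close>, so
  it exceeds \<open>K\<close>.\<close>

lemma infinite_primitive_incomplete: "infinite {t. primitive_incomplete_number N M spectrum t}"
  unfolding infinite_nat_iff_unbounded
proof
  fix K :: nat
  \<comment> \<open>The factor \<open>b\<close> ensures \<open>b - 1 \<le> m\<close>, as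
    \<open>incomplete_repunit\<close> requires; the factorial excludes small divisors.\<close>
  define m where "m = Suc (b * fact (b * K))"
  define u where "u = (\<Sum>k<m. b ^ k)"
  have "b * 1 \<le> b * fact (b * K)" by (intro mult_le_mono) (auto simp: fact_ge_1)
  then have "b - 1 \<le> m" unfolding m_def by linarith
  then have inc: "\<not> complete_number M spectrum (real u)" unfolding u_def by (rule incomplete_repunit)
  have u: "u = b * (\<Sum>k<b * fact (b * K). b ^ k) + 1"
    unfolding u_def m_def by (subst sum.lessThan_Suc_shift) (simp add: sum_distrib_left)
  define d where "d = (LEAST d. d dvd u \<and> \<not> complete_number M spectrum (real d))"
  have d: "d dvd u" "\<not> complete_number M spectrum (real d)"
    unfolding d_def using LeastI[of "\<lambda>d. d dvd u \<and> \<not> complete_number M spectrum (real d)" u] inc by auto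
  have least: "complete_number M spectrum (real e)" if "e dvd u" "e < d" for e
    using not_less_Least[of e "\<lambda>d. d dvd u \<and> \<not> complete_number M spectrum (real d)"] that by (auto simp: d_def)
  have "d \<noteq> 1" using d(2) complete_1 by auto
  then have "d > K"
    using repunit_without_small_divisors[of d K] d(1) unfolding u_def m_def by fastforce
  have "d > 0" using d(1) u by (intro Nat.gr0I) auto
  have "coprime (b * (\<Sum>k<b * fact (b * K). b ^ k)) u" by (simp add: u)
  then have "coprime N u" by (simp add: b)
  then have "coprime d N" using coprime_divisors[OF dvd_refl d(1)] coprime_commute by blast
  moreover have "complete_number M spectrum (real e)" if e: "e dvd d" "e \<noteq> d" for e
  proof (rule least)
    show "e dvd u" using e(1) d(1) by (rule dvd_trans)
    show "e < d" using dvd_imp_le[OF e(1) \<open>d > 0\<close>] e(2) by simp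
  qed
  ultimately have "primitive_incomplete_number N M spectrum d"
    using d(2) \<open>d > 0\<close> by (simp add: primitive_incomplete_number_def incomplete_number_def)
  then show "\<exists>n>K. n \<in> {t. primitive_incomplete_number N M spectrum t}" using \<open>d > K\<close> by auto
qed

end

theorem theorem1p7:
  fixes N q b :: nat and D C \<Lambda> :: "real set" and \<mu> :: "real measure"
  assumes "N \<ge> 2" and "q \<ge> 2" and "b = q * N"
    and "D = real ` {0..N - 1}"
    and "C = {- (real N / 2)<..real N / 2} \<inter> \<int>"
    and "\<mu> = self_similar_measure (real b) ((\<lambda>d. real q * d) ` D)"
    and "\<Lambda> = digit_expansions (real b) C"
  shows "infinite {t. primitive_complete_number N b \<mu> \<Lambda> t} \<and>
         infinite {t. primitive_incomplete_number N \<mu> \<Lambda> t}"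
proof -
  let ?B = "(\<lambda>d. real q * d) ` D"
  have "2 * 2 \<le> b" unfolding \<open>b = q * N\<close> using assms(1,2) by (intro mult_le_mono)
  then have b1: "real b > 1" by simp
  have B: "finite ?B" "?B \<noteq> {}" by (auto simp: \<open>D = _\<close>)
  \<comment> \<open>The largest digit is \<open>q * (N - 1) = b - q\<close>, which places the
    measure on the unit interval.\<close>
  have "real q * real d \<le> real b - 1" if "d \<le> N - 1" for d
  proof -
    have "q * (d + 1) \<le> b" unfolding \<open>b = q * N\<close> using that assms(1) by (intro mult_le_mono) auto
    then have "q * d + 1 \<le> b" using assms(2) by simp
    then have "real (q * d + 1) \<le> real b" by (simp only: of_nat_le_iff)
    then show ?thesis by simp
  qed
  then have "?B \<subseteq> {0..real b - 1}" by (auto simp: \<open>D = _\<close>)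
  then obtain M where M: "is_self_similar_measure (real b) ?B M" "AE x in M. x \<in> {0..1}"
    using self_similar_exists[OF b1 B] by blast
  interpret cantor_measure N q b M
    by unfold_locales (use assms M in auto)
  have "\<mu> = M" using self_similar_measure_eq[OF b1 B M(1)] assms(6) by simp
  moreover have "\<Lambda> = spectrum" using assms(5,7) by (simp add: digit_expansions_eq spectrum_def)
  ultimately show ?thesis using infinite_primitive_complete infinite_primitive_incomplete by simp
qed

end
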